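(* Let $1\le T<S$. Consider a linear private information retrieval scheme over a finite field $\mathbb{F}_p$ with $M\ge2$ messages and $S\ge2$ servers of which $T$ may collude, as described in the context, satisfying correctness and colluding privacy. Then the scheme achieves the colluding PIR capacity, i.e. its rate satisfies $$\mathcal{R}=\frac{1-\frac TS}{1-\left(\frac TS\right)^M},$$ if and only if the following two conditions hold (for every realization of the queries of positive probability): (1) for all $m\in[1:M]$ and all $\bar{\mathcal{I}}\subset[1:M]\setminus\{m\}$, with $\mathcal{I}=[1:M]\setminus\bar{\mathcal{I}}$, $\ \operatorname{rank}Q_{1:S}^{(m)}[\mathcal{I}]=\sum_{j=1}^S\operatorname{rank}Q_j^{(m)}[\mathcal{I}]$; (2) for all $\mathcal{T}\subset[1:S]$ with $|\mathcal{T}|=T$ and all $m\in[1:M]$, $\ \operatorname{rank}Q_{1:S}^{(m)}[\bar m]=\sum_{j\in\mathcal{T}}\operatorname{rank}Q_j^{(m)}[\bar m]$, where $\bar m=[1:M]\setminus\{m\}$.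
   Context: Notation: $[1:Z]=\{1,\dots,Z\}$; $\mathbb{F}_p$ is a finite field of order $p$; entropies $H$ are measured with logarithms to base $p$. Setting: each of $S$ servers stores the same $M$ messages $W_1,\dots,W_M$, column vectors of length $L_w$ over $\mathbb{F}_p$, which are independent with $H(W_1)=\dots=H(W_M)=L_w$ (i.e. independent and uniform on $\mathbb{F}_p^{L_w}$). To retrieve message $W_m$, the user sends randomly generated queries $Q_j^{(m)}$ to the servers $j\in[1:S]$; the queries take finitely many values and are independent of the messages. In a linear scheme, $Q_j^{(m)}=(Q_j^{(m)}[1],\dots,Q_j^{(m)}[M])$ is a matrix over $\mathbb{F}_p$ in which each block $Q_j^{(m)}[k]$ has $L_w$ columns, and server $j$ returns $X_j^{(m)}=\sum_{k=1}^M Q_j^{(m)}[k]W_k$. For $\mathcal{J}\subset[1:M]$, $Q_j^{(m)}[\mathcal{J}]$ is the submatrix consisting of the blocks $Q_j^{(m)}[k]$, $k\in\mathcal{J}$, and $Q_{1:S}^{(m)}[\mathcal{J}]$ is the matrix obtained by stacking $Q_1^{(m)}[\mathcal{J}],\dots,Q_S^{(m)}[\mathcal{J}]$ vertically. $Q_{1:S}^{(m)}$ and $X_{1:S}^{(m)}$ denote all queries and all responses, and $Q_{\mathcal{T}}^{(m)}=(Q_j^{(m)})_{j\in\mathcal{T}}$. Correctness: $H(W_m\mid X_{1:S}^{(m)},Q_{1:S}^{(m)})=0$ for all $m\in[1:M]$. Colluding privacy: for every $\mathcal{T}\subset[1:S]$ with $|\mathcal{T}|=T$, the joint distribution of $Q_{\mathcal{T}}^{(m)}$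 does not depend on $m\in[1:M]$. Rate: $\displaystyle \mathcal{R}=\min_{m\in[1:M]}\frac{H(W_m)}{\sum_{i=1}^S H(X_i^{(m)}\mid Q_i^{(m)})}$. Every scheme with correctness and colluding privacy has $\mathcal{R}\le\frac{1-T/S}{1-(T/S)^M}$, and this upper bound is called the colluding PIR capacity. *)

theory Defs
  imports
    "HOL-Probability.Information"
    "Jordan_Normal_Form.DL_Rank"
    "Jordan_Normal_Form.DL_Submatrix"
begin

definition mat_rank :: "'a::field mat \<Rightarrow> nat" where
  "mat_rank A = vec_space.rank (dim_row A) A"

text \<open>Columns are numbered from 0 and messages from 1, so the block of message \<open>k\<close> occupies the
  columns \<open>(k - 1) * L, \<dots>, k * L - 1\<close>.\<close>

definition blocks :: "nat \<Rightarrow> nat set \<Rightarrow> 'a mat \<Rightarrow> 'a mat" where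
  "blocks L J A = submatrix A UNIV (\<Union>k\<in>J. {(k - 1) * L..<k * L})"

text \<open>The matrices \<open>A 1, \<dots>, A S\<close>, which have a common number of columns, stacked vertically.\<close>

definition stack :: "nat \<Rightarrow> (nat \<Rightarrow> 'a mat) \<Rightarrow> 'a mat" where
  "stack S A = mat_of_rows (dim_col (A 1)) (concat (map (\<lambda>j. rows (A j)) [1..<Suc S]))"

definition response :: "nat \<Rightarrow> nat \<Rightarrow> 'a::field mat \<Rightarrow> (nat \<Rightarrow> 'a vec) \<Rightarrow> 'a vec" where
  "response M L A w =
     finsum_vec TYPE('a) (dim_row A) (\<lambda>k. blocks L {k} A *\<^sub>v w k) {1..M}"

definition joint :: "nat set \<Rightarrow> (nat \<Rightarrow> 'w \<Rightarrow> 'b) \<Rightarrow> 'w \<Rightarrow> nat \<Rightarrow> 'b" where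
  "joint J Y \<omega> = (\<lambda>j\<in>J. Y j \<omega>)"

text \<open>Entropies to base \<open>b\<close> of random variables with finite range, as in
  \<^locale>\<open>information_space\<close>'s notation.\<close>

definition entropy_rv :: "'w measure \<Rightarrow> real \<Rightarrow> ('w \<Rightarrow> 'b) \<Rightarrow> real" where
  "entropy_rv P b Y = prob_space.entropy P b (count_space (Y ` space P)) Y"

definition cond_entropy_rv :: "'w measure \<Rightarrow> real \<Rightarrow> ('w \<Rightarrow> 'b) \<Rightarrow> ('w \<Rightarrow> 'c) \<Rightarrow> real" where
  "cond_entropy_rv P b Y Z =
     prob_space.conditional_entropy P b (count_space (Y ` space P)) (count_space (Z ` space P)) Y Z"

text \<open>\<open>Q m j\<close> is the query sent to server \<open>j\<close> when message \<open>m\<close> is wanted; its number of rows may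
  depend on \<open>m\<close>, \<open>j\<close> and the outcome. Independence of queries and messages is written with
  \<open>indep_set\<close> because \<open>indep_var\<close> requires both variables to have the same value type.\<close>

locale linear_scheme = prob_space P for P :: "'w measure" +
  fixes M S L :: nat
    and W :: "nat \<Rightarrow> 'w \<Rightarrow> 'a::{field,finite} vec"
    and Q :: "nat \<Rightarrow> nat \<Rightarrow> 'w \<Rightarrow> 'a::{field,finite} mat"
  assumes messages_indep: "indep_vars (\<lambda>k. count_space (carrier_vec L)) W {1..M}"
    and messages_entropy: "k \<in> {1..M} \<Longrightarrow> entropy_rv P (real CARD('a)) (W k) = real L"
    and queries_simple: "\<lbrakk>m \<in> {1..M}; j \<in> {1..S}\<rbrakk> \<Longrightarrow> simple_function P (Q m j)"
    and queries_dim: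
      "\<lbrakk>m \<in> {1..M}; j \<in> {1..S}; \<omega> \<in> space P\<rbrakk> \<Longrightarrow> dim_col (Q m j \<omega>) = M * L"
    and queries_indep_messages:
      "m \<in> {1..M} \<Longrightarrow>
        indep_set {joint {1..S} (Q m) -` A \<inter> space P | A. True}
                  {joint {1..M} W -` B \<inter> space P | B. True}"
begin

definition X :: "nat \<Rightarrow> nat \<Rightarrow> 'w \<Rightarrow> 'a vec" where
  "X m j \<omega> = response M L (Q m j \<omega>) (\<lambda>k. W k \<omega>)"

definition correct :: bool where
  "correct \<longleftrightarrow> (\<forall>m\<in>{1..M}.
     cond_entropy_rv P (real CARD('a)) (W m)
       (\<lambda>\<omega>. (joint {1..S} (X m) \<omega>, joint {1..S} (Q m) \<omega>)) = 0)"

definition colluding_private :: "nat \<Rightarrow> bool" where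
  "colluding_private T \<longleftrightarrow> (\<forall>\<T>. \<T> \<subseteq> {1..S} \<and> card \<T> = T \<longrightarrow>
     (\<forall>m\<in>{1..M}. \<forall>m'\<in>{1..M}.
        distr P (count_space UNIV) (joint \<T> (Q m)) =
        distr P (count_space UNIV) (joint \<T> (Q m'))))"

definition rate :: real where
  "rate = Min ((\<lambda>m.
     entropy_rv P (real CARD('a)) (W m) /
     (\<Sum>i = 1..S. cond_entropy_rv P (real CARD('a)) (X m i) (Q m i))) ` {1..M})"

text \<open>\<open>q\<close> is a realization, of positive probability, of all the queries for message \<open>m\<close>.\<close>

definition realization :: "nat \<Rightarrow> (nat \<Rightarrow> 'a mat) \<Rightarrow> bool" where
  "realization m q \<longleftrightarrow> prob {\<omega> \<in> space P. \<forall>j\<in>{1..S}. Q m j \<omega> = q j} > 0"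

end

end

(* Fix a realization of the queries. The rank of the rows held by the servers in A, restricted to
   the columns of the messages in I, equals L |I| minus the logarithm (to base p) of the number of
   vectors supported on these columns that all servers in A annihilate. Counting in finite groups
   then gives everything needed about ranks, in particular submodularity in A.

   Let R_m(I) be the expected rank over all servers. Correctness gives R_m(I) = L + R_m(I - {m}) for
   m in I. Privacy makes the expected rank of T servers independent of the requested message, so
   Han's inequality yields R_m(J) >= (T/S) R_m'(J). Iterating, the expected download is at least
   L (1 + T/S + ... + (T/S)^(M-1)). At capacity every step is tight: equality in Han's inequality
   (where T < S is needed) says that the servers' row spaces are independent, which is (1), and
   R_m(J) being attained by every coalition gives (2). Conversely, (1), (2) and privacy give
   R_m(J) <= (T/S) * (sum of the ranks of the single servers) for all J without m, and the same
   recursion bounds the download from above. *)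
theory Submission
  imports Defs
begin

(* The subscript notation of HOL-Analysis vectors clashes with that of Jordan_Normal_Form. *)
unbundle no vec_syntax

section \<open>Han's inequality for submodular functions\<close>

text \<open>Privacy relates only the distributions of what \<open>T\<close> servers see under two
  requests; it gives no coupling of single realizations. Different requests are therefore compared
  through expected ranks only, although (1) and (2) speak of every realization. The way back rests
  on two facts: the queries take finitely many values, so each realization is an atom, and the
  inequalities in question hold at every realization, so equal expectations force equality at all
  atoms. Correctness concerns the requested message alone. A step of the recursion can thus split
  off only the block of the current request, and the request has to change before the next block can
  go; each change costs a factor T/S. As T >= 1, the query of a single server has the same law for
  every request, so the minimum in the rate is taken over equal numbers.\<close>

definition submodular_on :: "'a set \<Rightarrow> ('a set \<Rightarrow> real) \<Rightarrow> bool" where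
  "submodular_on U h \<longleftrightarrow>
     h {} = 0 \<and> (\<forall>A\<subseteq>U. \<forall>B\<subseteq>U. h (A \<union> B) + h (A \<inter> B) \<le> h A + h B)"

lemma submodular_onD:
  "submodular_on U h \<Longrightarrow> A \<subseteq> U \<Longrightarrow> B \<subseteq> U \<Longrightarrow> h (A \<union> B) + h (A \<inter> B) \<le> h A + h B"
  by (simp add: submodular_on_def)

lemma submodular_on_empty: "submodular_on U h \<Longrightarrow> h {} = 0"
  by (simp add: submodular_on_def)

lemma submodular_on_subset: "submodular_on U h \<Longrightarrow> V \<subseteq> U \<Longrightarrow> submodular_on V h"
  unfolding submodular_on_def by (meson order_trans)

lemma submodular_on_le_sum:
  assumes "submodular_on U h" "finite A" "A \<subseteq> U"
  shows "h A \<le> (\<Sum>i\<in>A. h {i})"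
  using assms(2,3)
proof (induction A)
  case (insert x A)
  then show ?case
    using submodular_onD[OF assms(1), of "{x}" A] submodular_on_empty[OF assms(1)] by auto
qed (simp add: submodular_on_empty[OF assms(1)])

text \<open>Diminishing returns: \<open>h U - h (U - {i})\<close>, the gain at the top of
  \<open>U\<close>, is the smallest gain that \<open>i\<close> can bring, so adding the elements of
  \<open>B\<close> to \<open>C\<close> one at a time gains at least the sum of these.\<close>

lemma submodular_on_marginals:
  assumes "submodular_on U h" "finite B" "C \<union> B \<subseteq> U" "C \<inter> B = {}"
  shows "h C + (\<Sum>i\<in>B. h U - h (U - {i})) \<le> h (C \<union> B)"
  using assms(2-4)
proof (induction B)
  case (insert x B)
  have "(C \<union> insert x B) \<union> (U - {x}) = U" "(C \<union> insert x B) \<inter> (U - {x}) = C \<union> B"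
    using insert by auto
  then have "h U + h (C \<union> B) \<le> h (C \<union> insert x B) + h (U - {x})"
    using submodular_onD[OF assms(1), of "C \<union> insert x B" "U - {x}"] insert.prems by auto
  then show ?case using insert by auto
qed auto

text \<open>The case \<open>k = card U - 1\<close> of Han's inequality: the gains at the top sum to
  at most \<open>h U\<close>.\<close>

lemma sum_delete_one_ge:
  assumes "submodular_on U h" "finite U"
  shows "(real (card U) - 1) * h U \<le> (\<Sum>i\<in>U. h (U - {i}))"
  using submodular_on_marginals[OF assms, of "{}"] submodular_on_empty[OF assms(1)]
  by (simp add: sum_subtractf algebra_simps)

text \<open>By hypothesis the gains \<open>d i\<close> at the top sum to at least
  \<open>h U\<close>. Replacing a single \<open>d i\<close> by \<open>h {i}\<close> still gives at
  most \<open>h U\<close>, whence \<open>h {i} \<le> d i\<close>; summing over \<open>i\<close>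
  returns to the previous bound.\<close>

lemma sum_le_if_sum_delete_one_le:
  assumes "submodular_on U h" "finite U"
    and "(\<Sum>i\<in>U. h (U - {i})) \<le> (real (card U) - 1) * h U"
  shows "(\<Sum>i\<in>U. h {i}) \<le> h U"
proof -
  define d where "d i = h U - h (U - {i})" for i
  have d: "h U \<le> (\<Sum>i\<in>U. d i)"
    using assms(3) by (simp add: d_def sum_subtractf algebra_simps)
  have "h {i} \<le> d i" if "i \<in> U" for i
  proof -
    have "h {i} + (\<Sum>j\<in>U - {i}. d j) \<le> h ({i} \<union> (U - {i}))"
      unfolding d_def by (rule submodular_on_marginals[OF assms(1)]) (use assms(2) that in auto)
    moreover have "{i} \<union> (U - {i}) = U" using that by auto
    moreover have "(\<Sum>j\<in>U. d j) = d i + (\<Sum>j\<in>U - {i}. d j)"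
      using assms(2) that by (rule sum.remove)
    ultimately show ?thesis using d by simp
  qed
  then have "(\<Sum>i\<in>U. h {i}) \<le> (\<Sum>i\<in>U. d i)" by (rule sum_mono)
  also have "\<dots> \<le> h U"
    using submodular_on_marginals[OF assms(1,2), of "{}"] submodular_on_empty[OF assms(1)]
    by (simp add: d_def)
  finally show ?thesis .
qed

abbreviation subsets_of_card :: "'a set \<Rightarrow> nat \<Rightarrow> 'a set set" where
  "subsets_of_card U k \<equiv> {A. A \<subseteq> U \<and> card A = k}"

text \<open>Double counting: a subset \<open>A\<close> of size \<open>k\<close> survives the
  deletion of \<open>i\<close> exactly for the \<open>card U - k\<close> elements \<open>i\<close>
  outside \<open>A\<close>.\<close>

lemma sum_subsets_delete_one:
  fixes h :: "'a set \<Rightarrow> real"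
  assumes "finite U"
  shows "(\<Sum>i\<in>U. \<Sum>A\<in>subsets_of_card (U - {i}) k. h A) =
    (real (card U) - real k) * (\<Sum>A\<in>subsets_of_card U k. h A)"
proof -
  have "(\<Sum>i\<in>U. \<Sum>A\<in>subsets_of_card (U - {i}) k. h A) =
      (\<Sum>i\<in>U. \<Sum>A\<in>{A\<in>subsets_of_card U k. i \<notin> A}. h A)"
    by (intro sum.cong refl) auto
  also have "\<dots> = (\<Sum>A\<in>subsets_of_card U k. \<Sum>i\<in>{i\<in>U. i \<notin> A}. h A)"
    by (rule sum.swap_restrict) (use assms in auto)
  also have "\<dots> = (\<Sum>A\<in>subsets_of_card U k. (real (card U) - real k) * h A)"
  proof (rule sum.cong[OF refl])
    fix A assume A: "A \<in> subsets_of_card U k"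
    have "{i\<in>U. i \<notin> A} = U - A" by auto
    moreover have "card (U - A) = card U - k"
      using A assms by (auto simp: card_Diff_subset finite_subset)
    moreover have "k \<le> card U" using A assms card_mono by blast
    ultimately show "(\<Sum>i\<in>{i\<in>U. i \<notin> A}. h A) = (real (card U) - real k) * h A"
      by (simp add: of_nat_diff)
  qed
  finally show ?thesis by (simp add: sum_distrib_left)
qed

lemma binomial_delete_one:
  assumes "k < n"
  shows "(real n - real k) * real (n choose k) = real n * real ((n - 1) choose k)"
proof -
  have "(n - k) * (n choose k) = n * ((n - 1) choose k)"
    by (rule binomial_absorb_comp)
  then have "real (n - k) * real (n choose k) = real n * real ((n - 1) choose k)"
    by (metis of_nat_mult)
  then show ?thesis using assms by (simp add: of_nat_diff)
qed

text \<open>In the usual form, the average of \<open>h A / k\<close> over the subsets of size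
  \<open>k\<close> is at least \<open>h U / card U\<close>; here it is free of divisions. The bound
  for deleting one element is combined with the induction hypothesis for every
  \<open>U - {i}\<close>, and double counting returns to the subsets of \<open>U\<close>.\<close>

lemma Han_inequality:
  assumes "submodular_on U h" "finite U" "1 \<le> k" "k \<le> card U"
  shows "real k * real (card U choose k) * h U \<le> real (card U) * (\<Sum>A\<in>subsets_of_card U k. h A)"
  using assms
proof (induction "card U" arbitrary: U)
  case (Suc n)
  show ?case
  proof (cases "k = card U")
    case True
    then have "subsets_of_card U k = {U}" using Suc.prems(2) card_subset_eq by blast
    then show ?thesis using True by simp
  next
    case False
    let ?H = "\<lambda>U. \<Sum>A\<in>subsets_of_card U k. h A"
    have kn: "k \<le> n" and n: "card U = Suc n" using False Suc by auto
    have IH: "real k * real (n choose k) * h (U - {i}) \<le> real n * ?H (U - {i})" if "i \<in> U" for i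
    proof -
      have c: "n = card (U - {i})" using n that Suc.prems(2) by simp
      show ?thesis
        using Suc.hyps(1)[OF c submodular_on_subset[OF Suc.prems(1)]] Suc.prems kn c by auto
    qed
    have "real k * real (n choose k) * (real n * h U)
        \<le> real k * real (n choose k) * (\<Sum>i\<in>U. h (U - {i}))"
      using sum_delete_one_ge[OF Suc.prems(1,2)] n by (intro mult_left_mono) auto
    also have "\<dots> \<le> (\<Sum>i\<in>U. real n * ?H (U - {i}))"
      by (subst sum_distrib_left, rule sum_mono) (rule IH)
    also have "\<dots> = real n * ((real (card U) - real k) * ?H U)"
      by (simp add: sum_distrib_left[symmetric] sum_subsets_delete_one[OF Suc.prems(2)])
    finally have "real n * (real k * real (n choose k) * h U)
        \<le> real n * ((real (card U) - real k) * ?H U)"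
      by (simp add: ac_simps)
    then have "real k * real (n choose k) * h U \<le> (real (card U) - real k) * ?H U"
      using kn Suc.prems(3) by simp
    then have "real (card U) * (real k * real (n choose k) * h U)
        \<le> real (card U) * ((real (card U) - real k) * ?H U)"
      by (rule mult_left_mono) simp
    also have "real (card U) * (real k * real (n choose k) * h U) =
        (real (card U) - real k) * (real k * real (card U choose k) * h U)"
      using binomial_delete_one[of k "card U"] kn n by (simp add: ac_simps)
    finally have "(real (card U) - real k) * (real k * real (card U choose k) * h U)
        \<le> (real (card U) - real k) * (real (card U) * ?H U)" by (simp add: ac_simps)
    then show ?thesis using kn n by (simp add: mult_le_cancel_left)
  qed
qed auto

text \<open>Equality at size \<open>k\<close> propagates to size \<open>card U - 1\<close>: Han's
  inequality on each \<open>U - {i}\<close> bounds the sum of the \<open>h (U - {i})\<close> by the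
  sum over subsets of size \<open>k\<close>, which \<open>eq\<close> bounds in turn. For
  \<open>k = card U\<close> the premise \<open>eq\<close> would carry no information, since
  \<open>U\<close> is its own only subset of that size.\<close>

lemma Han_equality:
  assumes "submodular_on U h" "finite U" "1 \<le> k" "k < card U"
    and eq: "real (card U) * (\<Sum>A\<in>subsets_of_card U k. h A) \<le> real k * real (card U choose k) * h U"
  shows "h U = (\<Sum>i\<in>U. h {i})"
proof -
  let ?H = "\<lambda>U. \<Sum>A\<in>subsets_of_card U k. h A"
  let ?n = "card U"
  have "real k * real ((?n - 1) choose k) * h (U - {i}) \<le> (real ?n - 1) * ?H (U - {i})"
    if "i \<in> U" for i
  proof -
    have "card (U - {i}) = ?n - 1" using that assms(2) by simp
    then show ?thesis
      using Han_inequality[OF submodular_on_subset[OF assms(1)], of "U - {i}" k] assms(2-4)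
      by (simp add: of_nat_diff)
  qed
  then have "real k * real ((?n - 1) choose k) * (\<Sum>i\<in>U. h (U - {i}))
      \<le> (\<Sum>i\<in>U. (real ?n - 1) * ?H (U - {i}))"
    unfolding sum_distrib_left by (intro sum_mono) (simp add: ac_simps)
  also have "\<dots> = (real ?n - 1) * ((real ?n - real k) * ?H U)"
    by (simp add: sum_distrib_left[symmetric] sum_subsets_delete_one[OF assms(2)])
  finally have "real ?n * (real k * real ((?n - 1) choose k) * (\<Sum>i\<in>U. h (U - {i})))
      \<le> real ?n * ((real ?n - 1) * ((real ?n - real k) * ?H U))"
    by (rule mult_left_mono) simp
  also have "\<dots> = (real ?n - 1) * (real ?n - real k) * (real ?n * ?H U)"
    by (simp add: ac_simps)
  also have "\<dots> \<le> (real ?n - 1) * (real ?n - real k) * (real k * real (?n choose k) * h U)"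
    using assms(3,4) by (intro mult_left_mono[OF eq]) auto
  also have "\<dots> = (real ?n - 1) * real k * h U * ((real ?n - real k) * real (?n choose k))"
    by (simp add: ac_simps)
  also have "\<dots> = (real ?n - 1) * real k * h U * (real ?n * real ((?n - 1) choose k))"
    using binomial_delete_one[OF assms(4)] by simp
  finally have "(real ?n * real k * real ((?n - 1) choose k)) * (\<Sum>i\<in>U. h (U - {i}))
      \<le> (real ?n * real k * real ((?n - 1) choose k)) * ((real ?n - 1) * h U)"
    by (simp add: ac_simps)
  moreover have "0 < real ?n * real k * real ((?n - 1) choose k)" using assms(3,4) by simp
  ultimately have "(\<Sum>i\<in>U. h (U - {i})) \<le> (real ?n - 1) * h U"
    by (simp only: mult_le_cancel_left_pos)
  then show ?thesis
    using sum_le_if_sum_delete_one_le[OF assms(1,2)] submodular_on_le_sum[OF assms(1,2)] by simp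
qed

section \<open>Counting kernels over finite fields\<close>

lemma card_carrier_vec: "card (carrier_vec n :: 'a::finite vec set) = CARD('a) ^ n"
  and finite_carrier_vec: "finite (carrier_vec n :: 'a::finite vec set)"
proof -
  have bij: "bij_betw (vec n) ({..<n} \<rightarrow>\<^sub>E (UNIV :: 'a set)) (carrier_vec n)"
    by (rule bij_betwI[where g = "\<lambda>v. \<lambda>i\<in>{..<n}. v $ i"]) (auto simp: fun_eq_iff PiE_def extensional_def)
  show "card (carrier_vec n :: 'a vec set) = CARD('a) ^ n"
    using bij_betw_same_card[OF bij] by (simp add: card_PiE)
  show "finite (carrier_vec n :: 'a vec set)"
    using bij_betw_finite[OF bij] by (simp add: finite_PiE)
qed

lemma minus_vec_right_cancel:
  fixes x y z :: "'a::ab_group_add vec"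
  assumes "x - z = y - z" "x \<in> carrier_vec n" "y \<in> carrier_vec n" "z \<in> carrier_vec n"
  shows "x = y"
proof (rule eq_vecI)
  fix i assume "i < dim_vec y"
  then have i: "i < dim_vec z" using assms by auto
  have "(x - z) $ i = (y - z) $ i" using assms(1) by simp
  then show "x $ i = y $ i" using i by simp
qed (use assms in auto)

text \<open>The rank is the size of a maximal independent set \<open>U\<close> of columns. Such a
  set spans the column space, and independence makes multiplication by the matrix \<open>B\<close>
  with columns \<open>U\<close> injective, so the column space has as many elements as there are
  coefficient vectors for \<open>U\<close>.\<close>

lemma card_col_space:
  fixes A :: "'a::{field,finite} mat"
  assumes "A \<in> carrier_mat r n"
  shows "card ((\<lambda>v. A *\<^sub>v v) ` carrier_vec n) = CARD('a) ^ mat_rank A"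
proof -
  interpret vec_space "TYPE('a)" r .
  have sub: "set (cols A) \<subseteq> carrier_vec r" using assms cols_dim by blast
  obtain U where U: "maximal U (\<lambda>T. T \<subseteq> set (cols A) \<and> lin_indpt T)"
    using maximal_exists[of "(\<lambda>T. T \<subseteq> set (cols A) \<and> lin_indpt T)" "card (set (cols A))" "{}"]
    by (meson List.finite_set card_mono empty_iff empty_subsetI finite_lin_indpt2 rev_finite_subset)
  then have indpt: "lin_indpt U" and Usub: "U \<subseteq> set (cols A)" by (auto simp: maximal_def)
  have fin: "finite U" using Usub finite_subset by blast
  have "span U = span (set (cols A))"
  proof
    show "span U \<subseteq> span (set (cols A))" using Usub span_is_monotone by blast
    have "s \<in> span U" if s: "s \<in> set (cols A)" for s
    proof (rule ccontr)
      assume n: "s \<notin> span U"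
      then have "lin_indpt (U \<union> {s})"
        using indpt Usub sub s
        by (meson lin_dep_iff_in_span span_mem subset_trans subsetD)
      moreover have "s \<notin> U" using n Usub sub span_mem by blast
      ultimately show False using U Usub s unfolding maximal_def by blast
    qed
    then show "span (set (cols A)) \<subseteq> span U"
      by (meson Usub span_is_submodule span_is_subset sub subset_trans subsetI)
  qed
  moreover have "mat_rank A = card U"
    using rank_card_indpt[OF assms U] assms by (simp add: mat_rank_def)
  moreover obtain us where us: "set us = U" "distinct us"
    using finite_distinct_list[OF fin] by blast
  define B where "B = mat_of_cols r us"
  have usr: "set us \<subseteq> carrier_vec r" using us Usub sub by auto
  have colsB: "cols B = us" using usr by (simp add: B_def)
  have B: "B \<in> carrier_mat r (card U)" using distinct_card[OF us(2)] us(1) by (simp add: B_def)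
  have "inj_on (\<lambda>v. B *\<^sub>v v) (carrier_vec (card U))"
  proof (rule inj_onI)
    fix v w :: "'a vec" assume vw: "v \<in> carrier_vec (card U)" "w \<in> carrier_vec (card U)" "B *\<^sub>v v = B *\<^sub>v w"
    have "B *\<^sub>v w \<in> carrier_vec r" using B vw by simp
    then have "B *\<^sub>v (v - w) = 0\<^sub>v r"
      using vw B by (simp add: mult_minus_distrib_mat_vec)
    then have "v - w = w - w"
      using lin_depI[OF B, of "v - w"] vw colsB us indpt by auto
    then show "v = w" by (rule minus_vec_right_cancel) (use vw in auto)
  qed
  then have "card ((\<lambda>v. B *\<^sub>v v) ` carrier_vec (card U)) = CARD('a) ^ card U"
    by (simp add: card_image card_carrier_vec)
  moreover have "(\<lambda>v. B *\<^sub>v v) ` carrier_vec (card U) = span U"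
  proof -
    have "span U = col_space B" by (simp add: col_space_def colsB us)
    also have "\<dots> = (\<lambda>v. B *\<^sub>v v) ` carrier_vec (card U)"
      using col_space_eq[OF B] B by auto
    finally show ?thesis ..
  qed
  moreover have "(\<lambda>v. A *\<^sub>v v) ` carrier_vec n = span (set (cols A))"
    using col_space_eq[OF assms] assms by (auto simp: col_space_def)
  ultimately show ?thesis by simp
qed

text \<open>Subtracting \<open>w\<close> maps the fibre through \<open>w\<close> onto the
  kernel.\<close>

lemma card_fibre_mult_mat_vec:
  fixes A :: "'a::{field,finite} mat"
  assumes "A \<in> carrier_mat r n" "w \<in> carrier_vec n"
  shows "card {v \<in> carrier_vec n. A *\<^sub>v v = A *\<^sub>v w} = card {v \<in> carrier_vec n. A *\<^sub>v v = 0\<^sub>v r}"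
proof (rule bij_betw_same_card[of "\<lambda>v. v - w"], rule bij_betwI[where g = "\<lambda>v. v + w"])
  show "(\<lambda>v. v - w) \<in> {v \<in> carrier_vec n. A *\<^sub>v v = A *\<^sub>v w} \<rightarrow> {v \<in> carrier_vec n. A *\<^sub>v v = 0\<^sub>v r}"
    using assms by (auto simp: mult_minus_distrib_mat_vec)
  show "(\<lambda>v. v + w) \<in> {v \<in> carrier_vec n. A *\<^sub>v v = 0\<^sub>v r} \<rightarrow> {v \<in> carrier_vec n. A *\<^sub>v v = A *\<^sub>v w}"
    using assms by (auto simp: mult_add_distrib_mat_vec)
  show "v - w + w = v" if "v \<in> {v \<in> carrier_vec n. A *\<^sub>v v = A *\<^sub>v w}" for v
    using that assms(2) by (auto intro!: eq_vecI)
  show "v + w - w = v" if "v \<in> {v \<in> carrier_vec n. A *\<^sub>v v = 0\<^sub>v r}" for v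
    using that assms(2) by (auto intro!: eq_vecI)
qed

text \<open>Rank-nullity in counting form: each of the \<open>CARD('a) ^ mat_rank A\<close> values
  has a fibre of the size of the kernel.\<close>

lemma card_kernel_rank:
  fixes A :: "'a::{field,finite} mat"
  assumes "A \<in> carrier_mat r n"
  shows "CARD('a) ^ mat_rank A * card {v \<in> carrier_vec n. A *\<^sub>v v = 0\<^sub>v r} = CARD('a) ^ n"
proof -
  let ?f = "\<lambda>v. A *\<^sub>v v"
  have "CARD('a) ^ n = card (\<Union>y\<in>?f ` carrier_vec n. {v \<in> carrier_vec n. ?f v = y})"
    unfolding card_carrier_vec[symmetric] by (rule arg_cong[where f = card]) auto
  also have "\<dots> = (\<Sum>y\<in>?f ` carrier_vec n. card {v \<in> carrier_vec n. ?f v = y})"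
    by (rule card_UN_disjoint) (auto simp: finite_carrier_vec)
  also have "\<dots> = (\<Sum>y\<in>?f ` carrier_vec n. card {v \<in> carrier_vec n. ?f v = 0\<^sub>v r})"
    by (rule sum.cong[OF refl]) (auto simp: card_fibre_mult_mat_vec[OF assms])
  also have "\<dots> = CARD('a) ^ mat_rank A * card {v \<in> carrier_vec n. A *\<^sub>v v = 0\<^sub>v r}"
    by (simp add: card_col_space[OF assms])
  finally show ?thesis ..
qed

text \<open>For subgroups, |A + B| = |A| |B| / |A \<inter> B|, and A + B lies in C. The pairs in
  \<open>A \<times> B\<close> are counted by their difference, an element of \<open>C\<close>. Both
  the submodularity of ranks and the comparison of ranks across sets of columns are
  instances.\<close>

lemma card_mult_card_le_subgroups:
  fixes C :: "'a::{field,finite} vec set"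
  assumes "A \<subseteq> C" "B \<subseteq> C" "C \<subseteq> carrier_vec n"
    and A: "\<And>u v. u \<in> A \<Longrightarrow> v \<in> A \<Longrightarrow> u - v \<in> A"
    and B: "\<And>u v. u \<in> B \<Longrightarrow> v \<in> B \<Longrightarrow> u - v \<in> B"
    and C: "\<And>u v. u \<in> C \<Longrightarrow> v \<in> C \<Longrightarrow> u - v \<in> C"
  shows "card A * card B \<le> card (A \<inter> B) * card C"
proof -
  have "finite C" by (rule finite_subset[OF assms(3) finite_carrier_vec])
  then have fin: "finite C" "finite A" "finite B" using assms(1,2) finite_subset by auto
  define F where "F c = {(a, b). a \<in> A \<and> b \<in> B \<and> a - b = c}" for c
  have "card (F c) \<le> card (A \<inter> B)" if "F c \<noteq> {}" for c
  proof -
    obtain a0 b0 where 0: "a0 \<in> A" "b0 \<in> B" "a0 - b0 = c" using \<open>F c \<noteq> {}\<close> by (auto simp: F_def)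
    show ?thesis
    proof (rule card_inj_on_le)
      \<comment> \<open>Two pairs in one fibre differ by the same vector in both components, so this
        vector lies in \<open>A\<close> and in \<open>B\<close> and determines the second pair from
        the first.\<close>
      have eq: "a - a0 = b - b0" if "(a, b) \<in> F c" for a b
      proof -
        have car: "a \<in> carrier_vec n" "b \<in> carrier_vec n" "a0 \<in> carrier_vec n" "b0 \<in> carrier_vec n"
          using that 0(1,2) assms(1-3) unfolding F_def by blast+
        have "a - b = a0 - b0" using that 0 by (simp add: F_def)
        then have e: "(a - b) $ i = (a0 - b0) $ i" for i by simp
        show ?thesis
        proof (rule eq_vecI)
          fix i assume "i < dim_vec (b - b0)"
          then have "i < n" using car by auto
          with e[of i] car have "a $ i - b $ i = a0 $ i - b0 $ i" by simp
          with \<open>i < n\<close> car show "(a - a0) $ i = (b - b0) $ i" by (simp add: algebra_simps)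
        qed (use car in simp)
      qed
      show "(\<lambda>(a, b). a - a0) ` F c \<subseteq> A \<inter> B"
      proof (clarify, rule IntI)
        fix a b assume *: "(a, b) \<in> F c"
        show "a - a0 \<in> A" using * 0 A by (simp add: F_def)
        show "a - a0 \<in> B" unfolding eq[OF *] using * 0 B by (simp add: F_def)
      qed
      show "inj_on (\<lambda>(a, b). a - a0) (F c)"
      proof (rule inj_onI, clarify)
        fix a b a' b' assume *: "(a, b) \<in> F c" "(a', b') \<in> F c" "a - a0 = a' - a0"
        have car: "a \<in> carrier_vec n" "b \<in> carrier_vec n" "a' \<in> carrier_vec n" "b' \<in> carrier_vec n"
            "a0 \<in> carrier_vec n" "b0 \<in> carrier_vec n"
          using *(1,2) 0(1,2) assms(1-3) unfolding F_def by blast+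
        have "b - b0 = b' - b0" by (rule *(3)[unfolded eq[OF *(1)] eq[OF *(2)]])
        then show "a = a' \<and> b = b'"
          using minus_vec_right_cancel[OF *(3), of n] minus_vec_right_cancel[of b b0 b' n] car by simp
      qed
      show "finite (A \<inter> B)" using fin by simp
    qed
  qed
  then have F: "card (F c) \<le> card (A \<inter> B)" for c by (metis card.empty le0)
  have "a - b \<in> C" if "a \<in> A" "b \<in> B" for a b using that assms(1,2) C by blast
  then have "A \<times> B = (\<Union>c\<in>C. F c)" by (auto simp: F_def)
  then have "card A * card B = card (\<Union>c\<in>C. F c)" by (metis card_cartesian_product)
  also have "\<dots> \<le> (\<Sum>c\<in>C. card (F c))" by (rule card_UN_le[OF fin(1)])
  also have "\<dots> \<le> (\<Sum>c\<in>C. card (A \<inter> B))" by (rule sum_mono) (rule F)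
  finally show ?thesis by (simp add: mult.commute)
qed

section \<open>Vectors supported on a set of columns\<close>

definition supported :: "nat \<Rightarrow> nat set \<Rightarrow> 'a::zero vec set" where
  "supported n C = {v \<in> carrier_vec n. \<forall>i<n. i \<notin> C \<longrightarrow> v $ i = 0}"

text \<open>The coordinates are enumerated by \<open>pick\<close>, as \<open>submatrix\<close> does
  with its columns, so that the two fit together in products.\<close>

definition restrict_vec :: "nat set \<Rightarrow> 'a vec \<Rightarrow> 'a vec" where
  "restrict_vec C v = vec (card C) (\<lambda>j. v $ pick C j)"

lemma bij_betw_pick:
  assumes "finite C"
  shows "bij_betw (pick C) {..<card C} C"
proof -
  have "inj_on (pick C) {..<card C}"
    by (rule linorder_inj_onI') (metis lessThan_iff nat_neq_iff pick_mono_le)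
  moreover have "pick C ` {..<card C} \<subseteq> C" using pick_in_set_le by auto
  ultimately show ?thesis
    using assms by (metis bij_betw_def card_image card_lessThan card_subset_eq)
qed

lemma bij_betw_restrict_vec:
  assumes "C \<subseteq> {..<n}"
  shows "bij_betw (restrict_vec C) (supported n C) (carrier_vec (card C) :: 'a::zero vec set)"
proof -
  have fin: "finite C" using assms finite_subset by blast
  note pick = bij_betw_pick[OF fin]
  let ?g = "\<lambda>v. vec n (\<lambda>i. if i \<in> C then v $ the_inv_into {..<card C} (pick C) i else 0)"
  show ?thesis
  proof (rule bij_betwI[where g = ?g])
    show "restrict_vec C \<in> supported n C \<rightarrow> carrier_vec (card C)" by (simp add: restrict_vec_def)
    show "?g \<in> carrier_vec (card C) \<rightarrow> supported n C" by (auto simp: supported_def)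
    show "?g (restrict_vec C v) = v" if "v \<in> supported n C" for v :: "'a vec"
    proof (rule eq_vecI)
      fix i assume "i < dim_vec v"
      then have i: "i < n" using that by (auto simp: supported_def)
      have "the_inv_into {..<card C} (pick C) i \<in> {..<card C}" if "i \<in> C"
        using the_inv_into_into[OF bij_betw_imp_inj_on[OF pick], of i] that bij_betw_imp_surj_on[OF pick]
        by auto
      moreover have "pick C (the_inv_into {..<card C} (pick C) i) = i" if "i \<in> C"
        using f_the_inv_into_f_bij_betw[OF pick] that by auto
      ultimately show "?g (restrict_vec C v) $ i = v $ i"
        using i that by (auto simp: supported_def restrict_vec_def)
    qed (use that in \<open>auto simp: supported_def\<close>)
    show "restrict_vec C (?g v) = v" if "v \<in> carrier_vec (card C)" for v :: "'a vec"
    proof (rule eq_vecI)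
      fix j assume "j < dim_vec v"
      then have j: "j < card C" using that by auto
      then have "pick C j \<in> C" by (rule pick_in_set_le)
      moreover have "the_inv_into {..<card C} (pick C) (pick C j) = j"
        using the_inv_into_f_f[OF bij_betw_imp_inj_on[OF pick]] j by auto
      ultimately show "restrict_vec C (?g v) $ j = v $ j"
        using j assms by (auto simp: restrict_vec_def)
    qed (use that in \<open>auto simp: restrict_vec_def\<close>)
  qed
qed

lemma card_supported:
  assumes "C \<subseteq> {..<n}"
  shows "card (supported n C :: 'a::{zero,finite} vec set) = CARD('a) ^ card C"
  unfolding bij_betw_same_card[OF bij_betw_restrict_vec[OF assms]] by (rule card_carrier_vec)

lemma finite_supported: "finite (supported n C :: 'a::{zero,finite} vec set)"
  by (rule finite_subset[OF _ finite_carrier_vec]) (auto simp: supported_def)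

lemma dim_col_submatrix_UNIV:
  assumes "C \<subseteq> {..<dim_col A}"
  shows "dim_row (submatrix A UNIV C) = dim_row A" "dim_col (submatrix A UNIV C) = card C"
proof -
  have "{j. j < dim_col A \<and> j \<in> C} = C" using assms by auto
  then show "dim_row (submatrix A UNIV C) = dim_row A" "dim_col (submatrix A UNIV C) = card C"
    by (simp_all add: dim_submatrix)
qed

lemma submatrix_mult_restrict_vec:
  fixes A :: "'a::comm_ring_1 mat"
  assumes "C \<subseteq> {..<dim_col A}" "v \<in> supported (dim_col A) C"
  shows "submatrix A UNIV C *\<^sub>v restrict_vec C v = A *\<^sub>v v"
proof (rule eq_vecI)
  note dims = dim_col_submatrix_UNIV[OF assms(1)]
  have v: "dim_vec v = dim_col A" using assms(2) by (auto simp: supported_def)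
  have fin: "finite C" using assms finite_subset by blast
  have C: "{j. j < dim_col A \<and> j \<in> C} = C" using assms by auto
  fix i assume "i < dim_vec (A *\<^sub>v v)"
  then have i: "i < dim_row A" by simp
  have "(submatrix A UNIV C *\<^sub>v restrict_vec C v) $ i =
      (\<Sum>j<card C. A $$ (i, pick C j) * v $ pick C j)"
    using i dims
    by (auto simp: scalar_prod_def restrict_vec_def submatrix_index C pick_UNIV lessThan_atLeast0
        intro!: sum.cong)
  also have "\<dots> = (\<Sum>j\<in>C. A $$ (i, j) * v $ j)"
    by (rule sum.reindex_bij_betw[OF bij_betw_pick[OF fin]])
  also have "\<dots> = (\<Sum>j<dim_col A. A $$ (i, j) * v $ j)"
    by (rule sum.mono_neutral_left) (use assms in \<open>auto simp: supported_def\<close>)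
  also have "\<dots> = (A *\<^sub>v v) $ i"
    using i v by (auto simp: scalar_prod_def lessThan_atLeast0 intro!: sum.cong)
  finally show "(submatrix A UNIV C *\<^sub>v restrict_vec C v) $ i = (A *\<^sub>v v) $ i" .
qed (use dim_col_submatrix_UNIV[OF assms(1)] in simp)

text \<open>The vectors keep the full length \<open>n\<close> and only have to vanish outside
  \<open>C\<close>. Kernels for different sets of columns thus lie in one space and can be
  intersected and compared, unlike the kernels of submatrices of different widths.\<close>

definition common_kernel :: "nat \<Rightarrow> (nat \<Rightarrow> 'a::{field,finite} mat) \<Rightarrow> nat set \<Rightarrow> nat set \<Rightarrow> 'a vec set" where
  "common_kernel n q A C = {v \<in> supported n C. \<forall>j\<in>A. q j *\<^sub>v v = 0\<^sub>v (dim_row (q j))}"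

lemma card_common_kernel:
  assumes "C \<subseteq> {..<n}" "\<And>j. j \<in> A \<Longrightarrow> dim_col (q j) = n"
  shows "card {v \<in> carrier_vec (card C).
      \<forall>j\<in>A. submatrix (q j) UNIV C *\<^sub>v v = 0\<^sub>v (dim_row (q j))} = card (common_kernel n q A C)"
proof -
  have "bij_betw (restrict_vec C) (common_kernel n q A C)
      {v \<in> carrier_vec (card C). \<forall>j\<in>A. submatrix (q j) UNIV C *\<^sub>v v = 0\<^sub>v (dim_row (q j))}"
    unfolding common_kernel_def
  proof (rule bij_betw_Collect[OF bij_betw_restrict_vec[OF assms(1)]])
    fix v :: "'a vec" assume "v \<in> supported n C"
    then show "(\<forall>j\<in>A. submatrix (q j) UNIV C *\<^sub>v restrict_vec C v = 0\<^sub>v (dim_row (q j))) \<longleftrightarrow>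
        (\<forall>j\<in>A. q j *\<^sub>v v = 0\<^sub>v (dim_row (q j)))"
      using assms by (auto simp: submatrix_mult_restrict_vec)
  qed
  then show ?thesis by (simp add: bij_betw_same_card)
qed

lemma mat_of_rows_mult_eq_0_iff:
  assumes "set rs \<subseteq> carrier_vec n"
  shows "mat_of_rows n rs *\<^sub>v v = 0\<^sub>v (length rs) \<longleftrightarrow> (\<forall>r\<in>set rs. r \<bullet> v = 0)"
proof -
  have "mat_of_rows n rs *\<^sub>v v = 0\<^sub>v (length rs) \<longleftrightarrow> (\<forall>i<length rs. rs ! i \<bullet> v = 0)"
    using assms by (auto simp: vec_eq_iff subset_iff)
  then show ?thesis by (metis in_set_conv_nth)
qed

lemma mult_mat_vec_eq_0_iff: "A *\<^sub>v v = 0\<^sub>v (dim_row A) \<longleftrightarrow> (\<forall>r\<in>set (rows A). r \<bullet> v = 0)"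
  by (auto simp: vec_eq_iff rows_def)

lemma stack_mult_eq_0_iff:
  fixes A :: "nat \<Rightarrow> 'a::field mat"
  assumes "1 \<le> S" "\<And>j. j \<in> {1..S} \<Longrightarrow> dim_col (A j) = n"
  shows "stack S A *\<^sub>v v = 0\<^sub>v (dim_row (stack S A)) \<longleftrightarrow> (\<forall>j\<in>{1..S}. A j *\<^sub>v v = 0\<^sub>v (dim_row (A j)))"
proof -
  let ?rs = "concat (map (\<lambda>j. rows (A j)) [1..<Suc S])"
  have "dim_col (A 1) = n" using assms by simp
  then have st: "stack S A = mat_of_rows n ?rs" by (simp add: stack_def)
  have sub: "set ?rs \<subseteq> carrier_vec n" using assms(2) by (force simp: rows_def)
  have "stack S A *\<^sub>v v = 0\<^sub>v (dim_row (stack S A)) \<longleftrightarrow> (\<forall>r\<in>set ?rs. r \<bullet> v = 0)"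
    unfolding st using mat_of_rows_mult_eq_0_iff[OF sub] by (simp only: mat_of_rows_carrier)
  also have "\<dots> \<longleftrightarrow> (\<forall>j\<in>{1..S}. A j *\<^sub>v v = 0\<^sub>v (dim_row (A j)))"
    by (auto simp: mult_mat_vec_eq_0_iff)
  finally show ?thesis .
qed

section \<open>Ranks of blocks of queries\<close>

lemma CARD_field_gt_1: "1 < real CARD('a::{field,finite})"
proof -
  have "card {0, 1 :: 'a} \<le> CARD('a)" by (rule card_mono) auto
  then show ?thesis by simp
qed

definition block_cols :: "nat \<Rightarrow> nat set \<Rightarrow> nat set" where
  "block_cols L I = (\<Union>k\<in>I. {(k - 1) * L..<k * L})"

lemma blocks_eq_submatrix: "blocks L I A = submatrix A UNIV (block_cols L I)"
  by (simp add: blocks_def block_cols_def)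

text \<open>Columns count from 0 and messages from 1, hence the \<open>+ 1\<close>. If
  \<open>L = 0\<close>, no block has a column, while \<open>i div 0 = 0\<close> would point to
  message 1; the conjunct \<open>0 < L\<close> excludes this.\<close>

lemma mem_block_cols_iff:
  assumes "0 \<notin> I"
  shows "i \<in> block_cols L I \<longleftrightarrow> 0 < L \<and> i div L + 1 \<in> I"
proof
  assume "i \<in> block_cols L I"
  then obtain k where k: "k \<in> I" "(k - 1) * L \<le> i" "i < k * L" by (auto simp: block_cols_def)
  have "0 < L" using k(3) by (cases L) auto
  obtain l where l: "k = Suc l" using k(1) assms by (cases k) auto
  have "i div L = l" using k l by (intro div_nat_eqI) (auto simp: algebra_simps)
  then show "0 < L \<and> i div L + 1 \<in> I" using k l \<open>0 < L\<close> by simp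
next
  assume L: "0 < L \<and> i div L + 1 \<in> I"
  have "i div L * L \<le> i" "i < (i div L + 1) * L"
    using L dividend_less_div_times[of L i] by (auto simp: algebra_simps)
  then show "i \<in> block_cols L I"
    unfolding block_cols_def using L by (intro UN_I[of "i div L + 1"]) auto
qed

lemma block_cols_mono: "I \<subseteq> J \<Longrightarrow> block_cols L I \<subseteq> block_cols L J"
  by (auto simp: block_cols_def)

lemma block_cols_subset:
  assumes "I \<subseteq> {1..M}"
  shows "block_cols L I \<subseteq> {..<M * L}"
proof
  fix i assume "i \<in> block_cols L I"
  then obtain k where k: "k \<in> I" "i < k * L" by (auto simp: block_cols_def)
  have "k * L \<le> M * L" using k(1) assms by (intro mult_right_mono) auto
  with k(2) have "i < M * L" by (rule less_le_trans)
  then show "i \<in> {..<M * L}" by simp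
qed

lemma card_block_cols:
  assumes "I \<subseteq> {1..M}"
  shows "card (block_cols L I) = card I * L"
proof -
  have "card (block_cols L I) = (\<Sum>k\<in>I. card {(k - 1) * L..<k * L})"
    unfolding block_cols_def
  proof (rule card_UN_disjoint)
    show "finite I" using assms finite_subset by blast
    show "\<forall>k\<in>I. \<forall>k'\<in>I. k \<noteq> k' \<longrightarrow> {(k - 1) * L..<k * L} \<inter> {(k' - 1) * L..<k' * L} = {}"
    proof (intro ballI impI)
      fix k k' assume k: "k \<in> I" "k' \<in> I" "k \<noteq> k'"
      have "{(k - 1) * L..<k * L} \<inter> {(k' - 1) * L..<k' * L} = {}"
        if "k < k'" for k k' :: nat
      proof -
        have "k * L \<le> (k' - 1) * L" using that by (intro mult_right_mono) auto
        then show ?thesis by auto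
      qed
      then show "{(k - 1) * L..<k * L} \<inter> {(k' - 1) * L..<k' * L} = {}"
        using k(3) by (metis inf_commute nat_neq_iff)
    qed
  qed auto
  also have "\<dots> = (\<Sum>k\<in>I. L)"
  proof (rule sum.cong[OF refl])
    fix k assume "k \<in> I"
    then obtain l where "k = Suc l" using assms by (cases k) auto
    then show "card {(k - 1) * L..<k * L} = L" by simp
  qed
  finally show ?thesis by simp
qed

lemma finite_common_kernel: "finite (common_kernel n q A C)"
  by (rule finite_subset[OF _ finite_supported]) (auto simp: common_kernel_def)

lemma common_kernel_carrier: "common_kernel n q A C \<subseteq> carrier_vec n"
  by (auto simp: common_kernel_def supported_def)

lemma common_kernel_minus:
  assumes "\<And>j. j \<in> A \<Longrightarrow> dim_col (q j) = n"
    and "u \<in> common_kernel n q A C" "v \<in> common_kernel n q A C"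
  shows "u - v \<in> common_kernel n q A C"
proof -
  have car: "u \<in> carrier_vec n" "v \<in> carrier_vec n"
    using assms(2,3) by (auto simp: common_kernel_def supported_def)
  have "q j *\<^sub>v (u - v) = 0\<^sub>v (dim_row (q j))" if "j \<in> A" for j
  proof -
    have "q j \<in> carrier_mat (dim_row (q j)) n" using assms(1)[OF that] by auto
    then have "q j *\<^sub>v (u - v) = q j *\<^sub>v u - q j *\<^sub>v v"
      using car by (rule mult_minus_distrib_mat_vec)
    then show ?thesis using that assms(2,3) by (simp add: common_kernel_def)
  qed
  then show ?thesis using assms(2,3) by (auto simp: common_kernel_def supported_def)
qed

lemma zero_in_common_kernel:
  assumes "\<And>j. j \<in> A \<Longrightarrow> dim_col (q j) = n"
  shows "0\<^sub>v n \<in> common_kernel n q A C"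
proof -
  have "q j *\<^sub>v 0\<^sub>v n = 0\<^sub>v (dim_row (q j))" if "j \<in> A" for j
    using assms[OF that] by (auto simp: vec_eq_iff)
  then show ?thesis by (simp add: common_kernel_def supported_def)
qed

lemma card_common_kernel_pos:
  assumes "\<And>j. j \<in> A \<Longrightarrow> dim_col (q j) = n"
  shows "0 < card (common_kernel n q A C)"
proof -
  have "0\<^sub>v n \<in> common_kernel n q A C" using assms by (rule zero_in_common_kernel)
  then have "common_kernel n q A C \<noteq> {}" by blast
  then show ?thesis by (simp add: card_gt_0_iff finite_common_kernel)
qed

text \<open>Rank-nullity read as a definition: the number of columns minus the dimension of the
  common kernel. It makes sense for every set \<open>A\<close> of servers, even the empty one,
  without stacking matrices; for \<open>{j}\<close> and \<open>{1..S}\<close> it is identified with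
  the ranks in the theorem.\<close>

definition block_rank :: "nat \<Rightarrow> nat \<Rightarrow> (nat \<Rightarrow> 'a::{field,finite} mat) \<Rightarrow> nat set \<Rightarrow> nat set \<Rightarrow> real" where
  "block_rank M L q A I = real (card I * L) -
     log (real CARD('a)) (real (card (common_kernel (M * L) q A (block_cols L I))))"

lemma mat_rank_eq_log_kernel:
  fixes A :: "'a::{field,finite} mat"
  assumes "dim_col A = n"
  shows "real (mat_rank A) =
    real n - log (real CARD('a)) (real (card {v \<in> carrier_vec n. A *\<^sub>v v = 0\<^sub>v (dim_row A)}))"
proof -
  let ?p = "real CARD('a)" and ?K = "{v \<in> carrier_vec n. A *\<^sub>v v = 0\<^sub>v (dim_row A)}"
  have A: "A \<in> carrier_mat (dim_row A) n" using assms by auto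
  have eq: "?p ^ mat_rank A * real (card ?K) = ?p ^ n"
    using card_kernel_rank[OF A] by (metis of_nat_mult of_nat_power)
  have "0 < card ?K"
  proof (rule gr0I)
    assume "card ?K = 0"
    then show False using eq by simp
  qed
  then have "log ?p (?p ^ mat_rank A * real (card ?K)) = real (mat_rank A) + log ?p (real (card ?K))"
    using CARD_field_gt_1[where 'a = 'a] by (simp add: log_mult)
  then show ?thesis using CARD_field_gt_1[where 'a = 'a] by (simp add: eq)
qed

lemma mat_rank_blocks:
  assumes "I \<subseteq> {1..M}" "dim_col (q j) = M * L"
  shows "real (mat_rank (blocks L I (q j))) = block_rank M L q {j} I"
proof -
  have sub: "block_cols L I \<subseteq> {..<M * L}" using assms(1) by (rule block_cols_subset)
  have dims: "dim_col (blocks L I (q j)) = card I * L" "dim_row (blocks L I (q j)) = dim_row (q j)"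
    using dim_col_submatrix_UNIV[of "block_cols L I" "q j"] sub assms
    by (simp_all add: blocks_eq_submatrix card_block_cols[OF assms(1)])
  show ?thesis
    unfolding mat_rank_eq_log_kernel[OF dims(1)] block_rank_def dims(2)
    using card_common_kernel[OF sub, of "{j}" q] assms(2)
    by (simp add: card_block_cols[OF assms(1)] blocks_eq_submatrix)
qed

lemma mat_rank_stack_blocks:
  assumes "1 \<le> S" "I \<subseteq> {1..M}" "\<And>j. j \<in> {1..S} \<Longrightarrow> dim_col (q j) = M * L"
  shows "real (mat_rank (stack S (\<lambda>j. blocks L I (q j)))) = block_rank M L q {1..S} I"
proof -
  let ?B = "\<lambda>j. blocks L I (q j)"
  have sub: "block_cols L I \<subseteq> {..<M * L}" using assms(2) by (rule block_cols_subset)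
  have dims: "dim_col (?B j) = card I * L" "dim_row (?B j) = dim_row (q j)" if "j \<in> {1..S}" for j
    using dim_col_submatrix_UNIV[of "block_cols L I" "q j"] sub assms(3)[OF that]
    by (simp_all add: blocks_eq_submatrix card_block_cols[OF assms(2)])
  have dc: "dim_col (stack S ?B) = card I * L" using dims(1)[of 1] assms(1) by (simp add: stack_def)
  have "{v \<in> carrier_vec (card I * L). stack S ?B *\<^sub>v v = 0\<^sub>v (dim_row (stack S ?B))} =
      {v \<in> carrier_vec (card I * L). \<forall>j\<in>{1..S}. ?B j *\<^sub>v v = 0\<^sub>v (dim_row (q j))}"
    using stack_mult_eq_0_iff[OF assms(1) dims(1)] dims(2) by simp
  then show ?thesis
    unfolding mat_rank_eq_log_kernel[OF dc] block_rank_def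
    using card_common_kernel[OF sub, of "{1..S}" q] assms(3)
    by (simp add: card_block_cols[OF assms(2)] blocks_eq_submatrix)
qed

lemma mat_rank_eq_block_rank:
  assumes "dim_col (q j) = M * L"
  shows "real (mat_rank (q j)) = block_rank M L q {j} {1..M}"
proof -
  have sub: "i \<in> block_cols L {1..M}" if "i < M * L" for i
  proof -
    have "0 < L" using that by (cases L) auto
    then show ?thesis using that by (simp add: mem_block_cols_iff less_mult_imp_div_less Suc_le_eq)
  qed
  then have "common_kernel (M * L) q {j} (block_cols L {1..M}) =
      {v \<in> carrier_vec (M * L). q j *\<^sub>v v = 0\<^sub>v (dim_row (q j))}"
    by (auto simp: common_kernel_def supported_def)
  then show ?thesis
    by (simp add: mat_rank_eq_log_kernel[OF assms] block_rank_def)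
qed

lemma block_rank_cong: "(\<And>j. j \<in> A \<Longrightarrow> q j = q' j) \<Longrightarrow> block_rank M L q A I = block_rank M L q' A I"
  by (simp add: block_rank_def common_kernel_def)

lemma block_rank_no_servers:
  fixes q :: "nat \<Rightarrow> 'a::{field,finite} mat"
  assumes "I \<subseteq> {1..M}"
  shows "block_rank M L q {} I = 0"
proof -
  have "common_kernel (M * L) q {} (block_cols L I) = supported (M * L) (block_cols L I)"
    by (simp add: common_kernel_def)
  then have "card (common_kernel (M * L) q {} (block_cols L I)) = CARD('a) ^ (card I * L)"
    using card_supported[OF block_cols_subset[OF assms]] by (simp add: card_block_cols[OF assms])
  then show ?thesis using CARD_field_gt_1[where 'a = 'a] by (simp add: block_rank_def)
qed

lemma block_rank_mono:
  fixes q :: "nat \<Rightarrow> 'a::{field,finite} mat"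
  assumes "A \<subseteq> B" "\<And>j. j \<in> B \<Longrightarrow> dim_col (q j) = M * L"
  shows "block_rank M L q A I \<le> block_rank M L q B I"
proof -
  have "card (common_kernel (M * L) q B (block_cols L I)) \<le>
      card (common_kernel (M * L) q A (block_cols L I))"
    by (rule card_mono[OF finite_common_kernel]) (use assms(1) in \<open>auto simp: common_kernel_def\<close>)
  moreover have "0 < card (common_kernel (M * L) q B (block_cols L I))"
    using assms(2) by (rule card_common_kernel_pos)
  ultimately show ?thesis
    using CARD_field_gt_1[where 'a = 'a] by (simp add: block_rank_def)
qed

lemma log_card_mult_le:
  assumes "a * b \<le> c * (d :: nat)" "0 < a" "0 < b" "0 < c" "0 < d" "1 < p"
  shows "log p (real a) + log p (real b) \<le> log p (real c) + log p (real d)"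
proof -
  have "real a * real b \<le> real c * real d" using assms(1) by (metis of_nat_mult of_nat_mono)
  then have "log p (real a * real b) \<le> log p (real c * real d)" using assms(2-) by simp
  then show ?thesis using assms(2-) by (simp add: log_mult)
qed

text \<open>A union of sets of servers becomes an intersection of kernels, and the kernels of
  \<open>A\<close> and of \<open>B\<close> both lie in that of \<open>A \<inter> B\<close>.
  Submodularity is the logarithm of the product bound for subgroups.\<close>

lemma block_rank_submodular:
  fixes q :: "nat \<Rightarrow> 'a::{field,finite} mat"
  assumes "\<And>j. j \<in> A \<union> B \<Longrightarrow> dim_col (q j) = M * L"
  shows "block_rank M L q (A \<union> B) I + block_rank M L q (A \<inter> B) I
    \<le> block_rank M L q A I + block_rank M L q B I"
proof -
  let ?K = "\<lambda>A. common_kernel (M * L) q A (block_cols L I)"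
  have "card (?K A) * card (?K B) \<le> card (?K A \<inter> ?K B) * card (?K (A \<inter> B))"
  proof (rule card_mult_card_le_subgroups)
    show "?K A \<subseteq> ?K (A \<inter> B)" "?K B \<subseteq> ?K (A \<inter> B)" by (auto simp: common_kernel_def)
    show "?K (A \<inter> B) \<subseteq> carrier_vec (M * L)" by (rule common_kernel_carrier)
  qed (rule common_kernel_minus; use assms in auto)+
  moreover have "?K A \<inter> ?K B = ?K (A \<union> B)" by (auto simp: common_kernel_def)
  moreover have "0 < card (?K A)" "0 < card (?K B)" "0 < card (?K (A \<union> B))" "0 < card (?K (A \<inter> B))"
    by (rule card_common_kernel_pos; use assms in auto)+
  ultimately show ?thesis
    using log_card_mult_le[OF _ _ _ _ _ CARD_field_gt_1[where 'a = 'a]]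
    by (fastforce simp: block_rank_def)
qed

text \<open>What the servers in \<open>B - A\<close> add to the rank can only grow with the set of
  columns. The product bound is applied to the kernels of \<open>(A, I)\<close> and
  \<open>(B, J)\<close>: they meet in that of \<open>(B, I)\<close> and lie in that of
  \<open>(A, J)\<close>. The lemma serves to pass a zero contribution down to subsets of the
  messages.\<close>

lemma block_rank_diff_mono:
  fixes q :: "nat \<Rightarrow> 'a::{field,finite} mat"
  assumes "A \<subseteq> B" "I \<subseteq> J" "\<And>j. j \<in> B \<Longrightarrow> dim_col (q j) = M * L"
  shows "block_rank M L q B I - block_rank M L q A I \<le> block_rank M L q B J - block_rank M L q A J"
proof -
  let ?K = "\<lambda>A I. common_kernel (M * L) q A (block_cols L I)"
  have sub: "block_cols L I \<subseteq> block_cols L J" using assms(2) by (rule block_cols_mono)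
  have "card (?K A I) * card (?K B J) \<le> card (?K A I \<inter> ?K B J) * card (?K A J)"
  proof (rule card_mult_card_le_subgroups)
    show "?K A I \<subseteq> ?K A J" "?K B J \<subseteq> ?K A J"
      using sub assms(1) by (auto simp: common_kernel_def supported_def)
    show "?K A J \<subseteq> carrier_vec (M * L)" by (rule common_kernel_carrier)
  qed (rule common_kernel_minus; use assms in auto)+
  moreover have "?K A I \<inter> ?K B J = ?K B I"
    using sub assms(1) by (auto simp: common_kernel_def supported_def)
  moreover have "0 < card (?K A I)" "0 < card (?K B J)" "0 < card (?K B I)" "0 < card (?K A J)"
    by (rule card_common_kernel_pos; use assms in auto)+
  ultimately have "log (real CARD('a)) (real (card (?K A I))) + log (real CARD('a)) (real (card (?K B J)))
      \<le> log (real CARD('a)) (real (card (?K B I))) + log (real CARD('a)) (real (card (?K A J)))"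
    using log_card_mult_le[OF _ _ _ _ _ CARD_field_gt_1[where 'a = 'a]] by simp
  then show ?thesis by (simp add: block_rank_def)
qed

text \<open>If all vectors annihilated by the servers in \<open>A\<close> vanish on block
  \<open>m\<close>, the kernels over \<open>I\<close> and over \<open>I - {m}\<close> are the same
  set; only the number of columns changes, by \<open>L\<close>.\<close>

lemma block_rank_remove_determined_block:
  fixes q :: "nat \<Rightarrow> 'a::{field,finite} mat"
  assumes "I \<subseteq> {1..M}" "m \<in> I"
    and det: "\<And>u i. u \<in> carrier_vec (M * L) \<Longrightarrow> (\<And>j. j \<in> A \<Longrightarrow> q j *\<^sub>v u = 0\<^sub>v (dim_row (q j))) \<Longrightarrow>
      i < M * L \<Longrightarrow> i div L + 1 = m \<Longrightarrow> u $ i = 0"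
  shows "block_rank M L q A I = real L + block_rank M L q A (I - {m})"
proof -
  have "0 \<notin> I" using assms(1) by auto
  then have "common_kernel (M * L) q A (block_cols L I) =
      common_kernel (M * L) q A (block_cols L (I - {m}))"
    using det by (auto simp: common_kernel_def supported_def mem_block_cols_iff)
  moreover have "card I = Suc (card (I - {m}))"
    using assms(1,2) by (metis card.remove finite_atLeastAtMost finite_subset)
  ultimately show ?thesis by (simp add: block_rank_def algebra_simps)
qed

section \<open>Entropies of finite random variables\<close>

text \<open>Equality case of the maximum entropy bound. The terms run over all of \<open>A\<close>
  and not just over the range of \<open>X\<close>: a value that is never taken would leave the
  positive term \<open>1 / card A\<close>, so equality also forces every value of \<open>A\<close>
  to occur.\<close>

lemma (in information_space) uniform_if_entropy_eq_log_card:
  assumes X: "simple_function M X" and A: "X ` space M \<subseteq> A" "finite A"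
    and H: "entropy b (count_space (X ` space M)) X = log b (real (card A))" and a: "a \<in> A"
  shows "prob (X -` {a} \<inter> space M) = 1 / real (card A)"
proof -
  define f where "f a = prob (X -` {a} \<inter> space M)" for a
  let ?n = "real (card A)"
  have n: "0 < ?n" using A a by (auto simp: card_gt_0_iff)
  have dist: "simple_distributed M X f" using X by (rule simple_distributedI) (auto simp: f_def)
  have zero: "f x = 0" if "x \<notin> X ` space M" for x
  proof -
    have "X -` {x} \<inter> space M = {}" using that by auto
    then show ?thesis by (simp add: f_def)
  qed
  have "sum f A = sum f (X ` space M)"
    by (rule sum.mono_neutral_right) (use A zero in auto)
  also have "\<dots> = 1" using simple_distributed_sum_space[OF dist] .
  finally have sum1: "sum f A = 1" .
  have "entropy b (count_space (X ` space M)) X = - (\<Sum>x\<in>X ` space M. f x * log b (f x))"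
    using dist by (rule entropy_simple_distributed)
  also have "(\<Sum>x\<in>X ` space M. f x * log b (f x)) = (\<Sum>x\<in>A. f x * log b (f x))"
    by (rule sum.mono_neutral_left) (use A zero in auto)
  finally have "log b ?n = - (\<Sum>x\<in>A. f x * log b (f x))" using H by simp
  then have "ln ?n = - (\<Sum>x\<in>A. f x * ln (f x))"
    using b_gt_1 by (simp add: log_def sum_divide_distrib[symmetric] sum_negf[symmetric] divide_eq_eq)
  moreover have "(\<Sum>x\<in>A. f x * ln ?n) = ln ?n" by (simp add: sum_distrib_right[symmetric] sum1)
  ultimately have "(\<Sum>x\<in>A. f x * ln ?n) + (\<Sum>x\<in>A. f x * ln (f x)) = 0" by linarith
  moreover have "(\<Sum>x\<in>A. 1 / ?n - f x) = 0" using n by (simp add: sum_subtractf sum1)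
  ultimately have total: "(\<Sum>x\<in>A. 1 / ?n - f x + f x * ln ?n + f x * ln (f x)) = 0"
    by (simp add: sum.distrib)
  \<comment> \<open>\<open>ln y \<le> y - 1\<close>, with equality only at \<open>y = 1\<close>, applied to \<open>y = 1 / (n f x)\<close>\<close>
  have gibbs: "0 \<le> 1 / ?n - f x + f x * ln ?n + f x * ln (f x)"
    and tight: "1 / ?n - f x + f x * ln ?n + f x * ln (f x) = 0 \<Longrightarrow> f x = 1 / ?n" for x
  proof -
    have "0 \<le> 1 / ?n - f x + f x * ln ?n + f x * ln (f x) \<and>
      (1 / ?n - f x + f x * ln ?n + f x * ln (f x) = 0 \<longrightarrow> f x = 1 / ?n)"
    proof (cases "f x = 0")
      case True
      then show ?thesis using n by simp
    next
      case False
      then have pos: "0 < f x" by (simp add: f_def zero_less_measure_iff)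
      let ?y = "1 / (?n * f x)"
      have y: "0 < ?y" using n pos by simp
      have ln: "ln ?y = - ln ?n - ln (f x)" using n pos by (simp add: ln_div ln_mult)
      have eq: "1 / ?n - f x + f x * ln ?n + f x * ln (f x) = f x * (?y - 1 - ln ?y)"
        unfolding ln using n pos by (simp add: field_simps)
      have "ln ?y \<le> ?y - 1" using y by (rule ln_le_minus_one)
      moreover have "f x = 1 / ?n" if "ln ?y = ?y - 1"
        using ln_eq_minus_one[OF y that] n pos by (simp add: field_simps)
      ultimately show ?thesis unfolding eq using pos by auto
    qed
    then show "0 \<le> 1 / ?n - f x + f x * ln ?n + f x * ln (f x)"
      "1 / ?n - f x + f x * ln ?n + f x * ln (f x) = 0 \<Longrightarrow> f x = 1 / ?n" by auto
  qed
  have "1 / ?n - f a + f a * ln ?n + f a * ln (f a) = 0"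
    by (rule sum_nonneg_0[OF A(2) gibbs total a])
  then show ?thesis using tight by (simp add: f_def)
qed

lemma joint_eq_iff: "joint J Y \<omega> = joint J Y \<omega>' \<longleftrightarrow> (\<forall>j\<in>J. Y j \<omega> = Y j \<omega>')"
proof
  assume eq: "joint J Y \<omega> = joint J Y \<omega>'"
  show "\<forall>j\<in>J. Y j \<omega> = Y j \<omega>'"
  proof
    fix j assume "j \<in> J"
    then show "Y j \<omega> = Y j \<omega>'" using fun_cong[OF eq, of j] by (simp add: joint_def)
  qed
next
  assume "\<forall>j\<in>J. Y j \<omega> = Y j \<omega>'"
  then show "joint J Y \<omega> = joint J Y \<omega>'" unfolding joint_def by (intro restrict_ext) simp
qed

lemma simple_function_joint:
  assumes "finite J" "\<And>j. j \<in> J \<Longrightarrow> simple_function P (Y j)"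
  shows "simple_function P (joint J Y)"
  unfolding simple_function_def
proof safe
  have "joint J Y ` space P \<subseteq> (\<Pi>\<^sub>E j\<in>J. Y j ` space P)" by (auto simp: joint_def)
  moreover have "finite (\<Pi>\<^sub>E j\<in>J. Y j ` space P)"
    using assms by (intro finite_PiE) (auto simp: simple_functionD)
  ultimately show "finite (joint J Y ` space P)" by (rule finite_subset)
next
  fix \<omega> assume "\<omega> \<in> space P"
  have "joint J Y -` {joint J Y \<omega>} \<inter> space P = {\<omega>' \<in> space P. \<forall>j\<in>J. Y j \<omega>' = Y j \<omega>}"
    by (auto simp: joint_eq_iff)
  also have "\<dots> \<in> sets P"
  proof (rule sets.sets_Collect_finite_All[OF _ assms(1)])
    fix j assume "j \<in> J"
    have "{\<omega>' \<in> space P. Y j \<omega>' = Y j \<omega>} = Y j -` {Y j \<omega>} \<inter> space P" by auto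
    then show "{\<omega>' \<in> space P. Y j \<omega>' = Y j \<omega>} \<in> sets P"
      using simple_functionD(2)[OF assms(2)[OF \<open>j \<in> J\<close>]] by simp
  qed
  finally show "joint J Y -` {joint J Y \<omega>} \<inter> space P \<in> sets P" .
qed

lemma (in prob_space) expectation_simple:
  fixes g :: "'b \<Rightarrow> real"
  assumes "simple_function M Y"
  shows "(\<Sum>y\<in>Y ` space M. prob (Y -` {y} \<inter> space M) * g y) = (\<integral>x. g (Y x) \<partial>M)"
proof -
  have "simple_distributed M Y (\<lambda>y. prob (Y -` {y} \<inter> space M))"
    using assms by (rule simple_distributedI) auto
  then have "(\<integral>y. prob (Y -` {y} \<inter> space M) * g y \<partial>count_space (Y ` space M)) = (\<integral>x. g (Y x) \<partial>M)"
    by (intro distributed_integral[OF simple_distributed]) auto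
  then show ?thesis
    using simple_functionD(1)[OF assms] by (simp add: lebesgue_integral_count_space_finite)
qed

lemma (in prob_space) integrable_simple:
  fixes g :: "'b \<Rightarrow> real"
  assumes "simple_function M Y"
  shows "integrable M (\<lambda>x. g (Y x))"
proof -
  have fin: "finite ((\<lambda>x. g (Y x)) ` space M)"
    using simple_functionD(1)[OF simple_function_compose1[OF assms, of g]] .
  have meas: "(\<lambda>x. g (Y x)) \<in> borel_measurable M"
    using simple_function_compose1[OF assms, of g] by (rule borel_measurable_simple_function)
  have "AE x in M. norm (g (Y x)) \<le> Max ((\<lambda>y. \<bar>y\<bar>) ` (\<lambda>x. g (Y x)) ` space M)"
    using fin by (intro AE_I2) auto
  then show ?thesis using meas by (rule integrable_const_bound)
qed

lemma (in information_space) cond_entropy_rv_eq: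
  assumes X: "simple_function M X" and Y: "simple_function M Y"
  shows "cond_entropy_rv M b X Y = - (\<Sum>(x, y)\<in>(\<lambda>\<omega>. (X \<omega>, Y \<omega>)) ` space M.
    prob ((\<lambda>\<omega>. (X \<omega>, Y \<omega>)) -` {(x, y)} \<inter> space M) *
    log b (prob ((\<lambda>\<omega>. (X \<omega>, Y \<omega>)) -` {(x, y)} \<inter> space M) / prob (Y -` {y} \<inter> space M)))"
  unfolding cond_entropy_rv_def
  by (rule conditional_entropy_eq)
    (auto intro!: simple_distributedI simple_function_Pair X Y)

text \<open>The summands of the conditional entropy are nonnegative, so all of them vanish. A value
  of \<open>X\<close> that occurs together with \<open>y\<close> therefore carries the whole
  probability of \<open>y\<close>, and two distinct ones would need it twice. The events
  \<open>E1\<close> and \<open>E2\<close> only witness that both pairs have positive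
  probability.\<close>

lemma (in information_space) determined_if_cond_entropy_eq_0:
  assumes X: "simple_function M X" and Y: "simple_function M Y"
    and H: "cond_entropy_rv M b X Y = 0"
    and E: "0 < prob E1" "0 < prob E2" "E1 \<in> events" "E2 \<in> events"
    and E1: "\<And>\<omega>. \<omega> \<in> E1 \<Longrightarrow> X \<omega> = x1 \<and> Y \<omega> = y"
    and E2: "\<And>\<omega>. \<omega> \<in> E2 \<Longrightarrow> X \<omega> = x2 \<and> Y \<omega> = y"
  shows "x1 = x2"
proof (rule ccontr)
  assume ne: "x1 \<noteq> x2"
  define pxy where "pxy z = prob ((\<lambda>\<omega>. (X \<omega>, Y \<omega>)) -` {z} \<inter> space M)" for z
  define py where "py y = prob (Y -` {y} \<inter> space M)" for y
  let ?R = "(\<lambda>\<omega>. (X \<omega>, Y \<omega>)) ` space M"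
  have XY: "simple_function M (\<lambda>\<omega>. (X \<omega>, Y \<omega>))" using X Y by (rule simple_function_Pair)
  have le: "pxy (x, y) \<le> py y" for x y
    unfolding pxy_def py_def
    by (rule finite_measure_mono) (auto intro: simple_functionD(2)[OF Y])
  have nonneg: "0 \<le> - (pxy (x, y) * log b (pxy (x, y) / py y))" for x y
  proof (cases "pxy (x, y) = 0")
    case False
    then have pos: "0 < pxy (x, y)" by (simp add: pxy_def zero_less_measure_iff)
    then have "pxy (x, y) / py y \<le> 1" "0 < pxy (x, y) / py y" using le[of x y] by (simp_all add: divide_simps)
    then have "log b (pxy (x, y) / py y) \<le> 0" using b_gt_1 by simp
    then show ?thesis using pos by (simp add: mult_nonneg_nonpos)
  qed simp
  have "(\<Sum>z\<in>?R. - (pxy z * log b (pxy z / py (snd z)))) = 0"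
    using H unfolding cond_entropy_rv_eq[OF X Y] pxy_def py_def
    by (simp add: case_prod_unfold sum_negf)
  then have zero: "- (pxy z * log b (pxy z / py (snd z))) = 0" if "z \<in> ?R" for z
    using sum_nonneg_eq_0_iff[of ?R "\<lambda>z. - (pxy z * log b (pxy z / py (snd z)))"] that
      simple_functionD(1)[OF XY] nonneg by (metis prod.collapse)
  have full: "pxy (x, y) = py y" if Ex: "0 < prob E" "E \<in> events" "\<And>\<omega>. \<omega> \<in> E \<Longrightarrow> X \<omega> = x \<and> Y \<omega> = y" for x E
  proof -
    have "E \<noteq> {}" using Ex(1) by auto
    then obtain \<omega> where "\<omega> \<in> E" by blast
    then have "\<omega> \<in> space M" "(x, y) = (X \<omega>, Y \<omega>)"
      using Ex(3)[of \<omega>] sets.sets_into_space[OF Ex(2)] by auto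
    then have "(x, y) \<in> ?R" by blast
    moreover have "prob E \<le> pxy (x, y)"
      unfolding pxy_def using Ex(2,3) sets.sets_into_space[OF Ex(2)]
      by (intro finite_measure_mono) (auto intro: simple_functionD(2)[OF XY])
    ultimately have "pxy (x, y) > 0" "log b (pxy (x, y) / py y) = 0" using zero[of "(x, y)"] Ex(1) by auto
    moreover from this have r: "0 < pxy (x, y) / py y" using le[of x y] by simp
    ultimately have "ln (pxy (x, y) / py y) = 0" using b_gt_1 by (simp add: log_def)
    then have "pxy (x, y) / py y = 1" using r by (simp only: ln_eq_zero_iff)
    then show ?thesis by simp
  qed
  have "pxy (x1, y) + pxy (x2, y) =
      prob ((\<lambda>\<omega>. (X \<omega>, Y \<omega>)) -` {(x1, y)} \<inter> space M \<union> (\<lambda>\<omega>. (X \<omega>, Y \<omega>)) -` {(x2, y)} \<inter> space M)"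
    unfolding pxy_def using ne
    by (intro finite_measure_Union[symmetric]) (auto intro: simple_functionD(2)[OF XY])
  also have "\<dots> \<le> py y"
    unfolding py_def by (rule finite_measure_mono) (auto intro: simple_functionD(2)[OF Y])
  finally have "pxy (x1, y) + pxy (x2, y) \<le> py y" .
  moreover have "pxy (x1, y) = py y" using E(1,3) E1 by (rule full)
  moreover have "pxy (x2, y) = py y" using E(2,4) E2 by (rule full)
  moreover have "0 < py y"
  proof -
    have "prob E1 \<le> py y"
      unfolding py_def using E1 sets.sets_into_space[OF E(3)]
      by (intro finite_measure_mono) (auto intro: simple_functionD(2)[OF Y])
    then show ?thesis using E(1) by simp
  qed
  ultimately show False by simp
qed

section \<open>Entropies in linear schemes\<close>

lemma pick_atLeastLessThan:
  assumes "c < b - a"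
  shows "pick {a..<b} c = a + c"
proof -
  have "{x \<in> {a..<b}. x < a + c} = {a..<a + c}" using assms by auto
  then have "card {x \<in> {a..<b}. x < a + c} = c" by simp
  moreover have "a + c \<in> {a..<b}" using assms by auto
  ultimately show ?thesis using pick_card_in_set[of "a + c" "{a..<b}"] by simp
qed

context linear_scheme
begin

lemma information_space: "information_space P (real CARD('a))"
  by unfold_locales (rule CARD_field_gt_1)

section \<open>The messages as one uniformly distributed vector\<close>

definition message_vec :: "'w \<Rightarrow> 'a vec" where
  "message_vec \<omega> = vec (M * L) (\<lambda>i. W (i div L + 1) \<omega> $ (i mod L))"

definition message_block :: "nat \<Rightarrow> 'a vec \<Rightarrow> 'a vec" where
  "message_block k v = vec L (\<lambda>c. v $ ((k - 1) * L + c))"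

lemma message_vec_carrier: "message_vec \<omega> \<in> carrier_vec (M * L)"
  by (simp add: message_vec_def)

lemma block_index_less:
  assumes "k \<in> {1..M}" "c < L"
  shows "(k - 1) * L + c < M * L"
proof -
  obtain l where l: "k = Suc l" using assms(1) by (cases k) auto
  have "l * L + c < Suc l * L" using assms(2) by simp
  also have "\<dots> \<le> M * L" using assms(1) l by (intro mult_right_mono) auto
  finally show ?thesis using l by simp
qed

lemma W_carrier:
  assumes "k \<in> {1..M}" "\<omega> \<in> space P"
  shows "W k \<omega> \<in> carrier_vec L"
proof -
  have "random_variable (count_space (carrier_vec L)) (W k)"
    using messages_indep assms(1) by (simp add: indep_vars_def)
  from measurable_space[OF this assms(2)] show ?thesis by simp
qed

lemma message_block_message_vec:
  assumes "k \<in> {1..M}" "\<omega> \<in> space P"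
  shows "message_block k (message_vec \<omega>) = W k \<omega>"
proof (rule eq_vecI)
  have W: "dim_vec (W k \<omega>) = L" using W_carrier[OF assms] by simp
  show "dim_vec (message_block k (message_vec \<omega>)) = dim_vec (W k \<omega>)"
    by (simp add: W message_block_def)
  fix c assume "c < dim_vec (W k \<omega>)"
  then have c: "c < L" using W by simp
  have "((k - 1) * L + c) div L = k - 1" "((k - 1) * L + c) mod L = c" using c by simp_all
  moreover have "k - 1 + 1 = k" using assms(1) by simp
  ultimately show "message_block k (message_vec \<omega>) $ c = W k \<omega> $ c"
    using c block_index_less[OF assms(1) c] by (simp add: message_block_def message_vec_def)
qed

lemma message_vec_eq_iff:
  assumes "\<omega> \<in> space P" "v \<in> carrier_vec (M * L)"
  shows "message_vec \<omega> = v \<longleftrightarrow> (\<forall>k\<in>{1..M}. W k \<omega> = message_block k v)"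
proof
  assume "message_vec \<omega> = v"
  then show "\<forall>k\<in>{1..M}. W k \<omega> = message_block k v"
    using message_block_message_vec[OF _ assms(1)] by auto
next
  assume W: "\<forall>k\<in>{1..M}. W k \<omega> = message_block k v"
  show "message_vec \<omega> = v"
  proof (rule eq_vecI)
    fix i assume "i < dim_vec v"
    then have i: "i < M * L" using assms(2) by simp
    then have "0 < L" by (cases L) auto
    moreover have "i div L + 1 \<in> {1..M}" using i by (simp add: less_mult_imp_div_less Suc_le_eq)
    ultimately show "message_vec \<omega> $ i = v $ i"
      using W i by (simp add: message_vec_def message_block_def)
  qed (use assms in \<open>simp add: message_vec_def\<close>)
qed

lemma W_simple:
  assumes "k \<in> {1..M}"
  shows "simple_function P (W k)"
proof -
  have W: "random_variable (count_space (carrier_vec L)) (W k)"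
    using messages_indep assms by (simp add: indep_vars_def)
  show ?thesis
    unfolding simple_function_def
  proof (intro conjI ballI)
    have sub: "W k ` space P \<subseteq> carrier_vec L" using W_carrier[OF assms] by auto
    then show "finite (W k ` space P)" using finite_carrier_vec finite_subset by metis
    fix x assume "x \<in> W k ` space P"
    then show "W k -` {x} \<inter> space P \<in> sets P"
      using sub by (intro measurable_sets[OF W]) auto
  qed
qed

text \<open>The law of a message is given only through its entropy. \<open>L\<close> is the largest
  entropy possible on \<open>CARD('a) ^ L\<close> vectors, which forces uniformity.\<close>

lemma prob_W:
  assumes "k \<in> {1..M}" "w \<in> carrier_vec L"
  shows "prob (W k -` {w} \<inter> space P) = 1 / real CARD('a) ^ L"
proof -
  interpret information_space P "real CARD('a)" by (rule information_space)
  have card: "real (card (carrier_vec L :: 'a vec set)) = real CARD('a) ^ L"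
    by (simp add: card_carrier_vec)
  have "prob (W k -` {w} \<inter> space P) = 1 / real (card (carrier_vec L :: 'a vec set))"
  proof (rule uniform_if_entropy_eq_log_card[OF W_simple[OF assms(1)] _ finite_carrier_vec _ assms(2)])
    show "W k ` space P \<subseteq> carrier_vec L" using W_carrier[OF assms(1)] by auto
    show "entropy (real CARD('a)) (count_space (W k ` space P)) (W k) =
        log (real CARD('a)) (real (card (carrier_vec L :: 'a vec set)))"
      using messages_entropy[OF assms(1)] b_gt_1 unfolding card entropy_rv_def by simp
  qed
  then show ?thesis unfolding card .
qed

lemma message_vec_event:
  assumes "v \<in> carrier_vec (M * L)"
  shows "{\<omega> \<in> space P. message_vec \<omega> = v} =
    joint {1..M} W -` {\<lambda>k\<in>{1..M}. message_block k v} \<inter> space P"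
proof -
  have "joint {1..M} W \<omega> = (\<lambda>k\<in>{1..M}. message_block k v) \<longleftrightarrow> message_vec \<omega> = v"
    if "\<omega> \<in> space P" for \<omega>
    unfolding message_vec_eq_iff[OF that assms]
  proof
    assume eq: "joint {1..M} W \<omega> = (\<lambda>k\<in>{1..M}. message_block k v)"
    show "\<forall>k\<in>{1..M}. W k \<omega> = message_block k v"
    proof
      fix k assume "k \<in> {1..M}"
      then show "W k \<omega> = message_block k v" using fun_cong[OF eq, of k] by (simp add: joint_def)
    qed
  next
    assume "\<forall>k\<in>{1..M}. W k \<omega> = message_block k v"
    then show "joint {1..M} W \<omega> = (\<lambda>k\<in>{1..M}. message_block k v)"
      unfolding joint_def by (intro restrict_ext) simp
  qed
  then show ?thesis by blast
qed

lemma prob_message_vec: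
  assumes "v \<in> carrier_vec (M * L)" "1 \<le> M"
  shows "prob {\<omega> \<in> space P. message_vec \<omega> = v} = 1 / real CARD('a) ^ (M * L)"
proof -
  have "{\<omega> \<in> space P. message_vec \<omega> = v} = (\<Inter>k\<in>{1..M}. W k -` {message_block k v} \<inter> space P)"
  proof (rule Set.set_eqI)
    fix \<omega>
    have "\<exists>k\<ge>Suc 0. k \<le> M" using assms(2) by auto
    then show "\<omega> \<in> {\<omega> \<in> space P. message_vec \<omega> = v} \<longleftrightarrow>
        \<omega> \<in> (\<Inter>k\<in>{1..M}. W k -` {message_block k v} \<inter> space P)"
      unfolding INT_iff Int_iff vimage_singleton_eq mem_Collect_eq
      using message_vec_eq_iff[of \<omega>, OF _ assms(1)] by (cases "\<omega> \<in> space P") auto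
  qed
  also have "prob \<dots> = (\<Prod>k\<in>{1..M}. prob (W k -` {message_block k v} \<inter> space P))"
    by (rule indep_varsD_finite[OF messages_indep]) (use assms(2) in \<open>auto simp: message_block_def\<close>)
  also have "\<dots> = (\<Prod>k\<in>{1..M}. 1 / real CARD('a) ^ L)"
    by (rule prod.cong[OF refl], rule prob_W) (auto simp: message_block_def)
  also have "\<dots> = (1 / real CARD('a) ^ L) ^ M" by simp
  also have "\<dots> = 1 / real CARD('a) ^ (M * L)"
    by (simp only: power_one_over power_mult[symmetric] mult.commute[of L M])
  finally show ?thesis .
qed

section \<open>Queries and messages jointly\<close>

lemma query_event_in_events:
  assumes "m \<in> {1..M}"
  shows "joint {1..S} (Q m) -` A \<inter> space P \<in> events"
proof -
  have "{joint {1..S} (Q m) -` A \<inter> space P | A. True} \<subseteq> events"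
    using queries_indep_messages[OF assms] by (simp only: indep_sets2_eq)
  then show ?thesis by (rule subsetD) blast
qed

lemma message_event_in_events:
  assumes "m \<in> {1..M}" "v \<in> carrier_vec (M * L)"
  shows "{\<omega> \<in> space P. message_vec \<omega> = v} \<in> events"
proof -
  have "{joint {1..M} W -` B \<inter> space P | B. True} \<subseteq> events"
    using queries_indep_messages[OF assms(1)] by (simp only: indep_sets2_eq)
  then show ?thesis unfolding message_vec_event[OF assms(2)] by (rule subsetD) blast
qed

text \<open>Given any event of the queries, the message vector is still uniform, so probabilities
  reduce to counting the vectors in \<open>B\<close>.\<close>

lemma prob_query_message:
  assumes m: "m \<in> {1..M}" and B: "B \<subseteq> carrier_vec (M * L)"
  shows "prob (joint {1..S} (Q m) -` A \<inter> space P \<inter> {\<omega> \<in> space P. message_vec \<omega> \<in> B}) =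
    prob (joint {1..S} (Q m) -` A \<inter> space P) * real (card B) / real CARD('a) ^ (M * L)"
    "joint {1..S} (Q m) -` A \<inter> space P \<inter> {\<omega> \<in> space P. message_vec \<omega> \<in> B} \<in> events"
proof -
  let ?E = "joint {1..S} (Q m) -` A \<inter> space P" and ?V = "\<lambda>v. {\<omega> \<in> space P. message_vec \<omega> = v}"
  have fin: "finite B" by (rule finite_subset[OF B finite_carrier_vec])
  have un: "?E \<inter> {\<omega> \<in> space P. message_vec \<omega> \<in> B} = (\<Union>v\<in>B. ?E \<inter> ?V v)" by auto
  have ev: "?E \<inter> ?V v \<in> events" if "v \<in> B" for v
    by (rule sets.Int[OF query_event_in_events[OF m] message_event_in_events[OF m subsetD[OF B that]]])
  show "?E \<inter> {\<omega> \<in> space P. message_vec \<omega> \<in> B} \<in> events"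
    unfolding un using fin ev by (rule sets.finite_UN)
  have "prob (?E \<inter> ?V v) = prob ?E / real CARD('a) ^ (M * L)" if "v \<in> B" for v
  proof -
    have v: "v \<in> carrier_vec (M * L)" using that B by blast
    have "prob (?E \<inter> ?V v) = prob ?E * prob (?V v)"
      by (rule indep_setD[OF queries_indep_messages[OF m]]) (auto simp only: message_vec_event[OF v])
    then show ?thesis using prob_message_vec[OF v] m by simp
  qed
  then have "(\<Sum>v\<in>B. prob (?E \<inter> ?V v)) = (\<Sum>v\<in>B. prob ?E / real CARD('a) ^ (M * L))"
    by (rule sum.cong[OF refl])
  moreover have "prob (\<Union>v\<in>B. ?E \<inter> ?V v) = (\<Sum>v\<in>B. prob (?E \<inter> ?V v))"
    by (rule finite_measure_finite_Union) (use fin ev in \<open>auto simp: disjoint_family_on_def\<close>)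
  ultimately show "prob (?E \<inter> {\<omega> \<in> space P. message_vec \<omega> \<in> B}) =
      prob ?E * real (card B) / real CARD('a) ^ (M * L)"
    unfolding un by simp
qed

lemma query_event:
  assumes "j \<in> {1..S}"
  shows "Q m j -` {a} \<inter> space P = joint {1..S} (Q m) -` {f. f j = a} \<inter> space P"
  using assms by (auto simp: joint_def)

lemma realization_event:
  "{\<omega> \<in> space P. \<forall>j\<in>{1..S}. Q m j \<omega> = q j} =
    joint {1..S} (Q m) -` {f. \<forall>j\<in>{1..S}. f j = q j} \<inter> space P"
  by (auto simp: joint_def)

text \<open>Block multiplication: the response is one product of the query with the concatenated
  messages, which ties responses to the rank and the kernel of the query.\<close>

lemma X_eq_mult_message_vec:
  assumes "m \<in> {1..M}" "j \<in> {1..S}" "\<omega> \<in> space P"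
  shows "X m j \<omega> = Q m j \<omega> *\<^sub>v message_vec \<omega>"
proof -
  define A where "A = Q m j \<omega>"
  have A: "dim_col A = M * L" using queries_dim[OF assms] by (simp add: A_def)
  let ?C = "\<lambda>k. {(k - 1) * L..<k * L}"
  have blk: "blocks L {k} A = submatrix A UNIV (?C k)" for k by (simp add: blocks_def)
  have C: "?C k \<subseteq> {..<dim_col A}" "card (?C k) = L" if "k \<in> {1..M}" for k
    using block_cols_subset[of "{k}" M L] card_block_cols[of "{k}" M L] that A
    by (simp_all add: block_cols_def)
  have dims: "dim_row (blocks L {k} A) = dim_row A" "dim_col (blocks L {k} A) = L" if "k \<in> {1..M}" for k
    using dim_col_submatrix_UNIV[OF C(1)[OF that]] C(2)[OF that] by (simp_all add: blk)
  have term_k: "(blocks L {k} A *\<^sub>v W k \<omega>) $ i = (\<Sum>x\<in>?C k. A $$ (i, x) * message_vec \<omega> $ x)"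
    if k: "k \<in> {1..M}" and i: "i < dim_row A" for k i
  proof -
    have Wk: "W k \<omega> = message_block k (message_vec \<omega>)"
      using message_block_message_vec[OF k assms(3)] by simp
    have kL: "k * L = (k - 1) * L + L" using k by (cases k) auto
    have entry: "blocks L {k} A $$ (i, c) = A $$ (i, (k - 1) * L + c)" if "c < L" for c
    proof -
      have CA: "{x. x < dim_col A \<and> x \<in> ?C k} = ?C k" using C(1)[OF k] by auto
      have "submatrix A UNIV (?C k) $$ (i, c) = A $$ (pick UNIV i, pick (?C k) c)"
      proof (rule submatrix_index)
        show "i < card {i. i < dim_row A \<and> i \<in> UNIV}" using i by simp
        show "c < card {x. x < dim_col A \<and> x \<in> ?C k}" unfolding CA C(2)[OF k] by (rule that)
      qed
      moreover have "pick (?C k) c = (k - 1) * L + c"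
        by (rule pick_atLeastLessThan) (use that kL in simp)
      ultimately show ?thesis by (simp add: blk pick_UNIV)
    qed
    have "(blocks L {k} A *\<^sub>v W k \<omega>) $ i = (\<Sum>c\<in>{0..<L}. A $$ (i, (k - 1) * L + c) * message_vec \<omega> $ ((k - 1) * L + c))"
      using i dims[OF k] entry by (auto simp: scalar_prod_def Wk message_block_def intro!: sum.cong)
    also have "\<dots> = (\<Sum>x\<in>?C k. A $$ (i, x) * message_vec \<omega> $ x)"
      using sum.shift_bounds_nat_ivl[of "\<lambda>x. A $$ (i, x) * message_vec \<omega> $ x" 0 "(k - 1) * L" L]
      by (simp add: kL add.commute)
    finally show ?thesis .
  qed
  have car: "(\<lambda>k. blocks L {k} A *\<^sub>v W k \<omega>) \<in> {1..M} \<rightarrow> carrier_vec (dim_row A)"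
  proof
    fix k assume k: "k \<in> {1..M}"
    show "blocks L {k} A *\<^sub>v W k \<omega> \<in> carrier_vec (dim_row A)"
      by (rule carrier_vecI) (simp only: dim_mult_mat_vec dims(1)[OF k])
  qed
  show ?thesis
    unfolding X_def response_def A_def[symmetric]
  proof (rule eq_vecI)
    show "dim_vec (finsum_vec TYPE('a) (dim_row A) (\<lambda>k. blocks L {k} A *\<^sub>v W k \<omega>) {1..M}) =
        dim_vec (A *\<^sub>v message_vec \<omega>)"
      using finsum_vec_closed[OF car] by auto
    fix i assume "i < dim_vec (A *\<^sub>v message_vec \<omega>)"
    then have i: "i < dim_row A" by simp
    have "finsum_vec TYPE('a) (dim_row A) (\<lambda>k. blocks L {k} A *\<^sub>v W k \<omega>) {1..M} $ i =
        (\<Sum>k\<in>{1..M}. (blocks L {k} A *\<^sub>v W k \<omega>) $ i)"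
      using index_finsum_vec[OF _ i car] by simp
    also have "\<dots> = (\<Sum>k\<in>{1..M}. \<Sum>x\<in>?C k. A $$ (i, x) * message_vec \<omega> $ x)"
      by (rule sum.cong[OF refl], rule term_k) (use i in auto)
    \<comment> \<open>The blocks are brought into the form that \<open>sum.nat_group\<close> merges
      into one range.\<close>
    also have "\<dots> = (\<Sum>k\<in>{1..M}. \<Sum>x\<in>{(k - 1) * L..<(k - 1) * L + L}. A $$ (i, x) * message_vec \<omega> $ x)"
    proof (rule sum.cong[OF refl])
      fix k assume "k \<in> {1..M}"
      then have "k * L = (k - 1) * L + L" by (cases k) auto
      then show "(\<Sum>x\<in>?C k. A $$ (i, x) * message_vec \<omega> $ x) =
          (\<Sum>x\<in>{(k - 1) * L..<(k - 1) * L + L}. A $$ (i, x) * message_vec \<omega> $ x)" by simp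
    qed
    also have "\<dots> = (\<Sum>k<M. \<Sum>x\<in>{k * L..<k * L + L}. A $$ (i, x) * message_vec \<omega> $ x)"
      by (rule sum.reindex_bij_witness[of _ Suc "\<lambda>k. k - 1"]) auto
    also have "\<dots> = (\<Sum>x<M * L. A $$ (i, x) * message_vec \<omega> $ x)" by (rule sum.nat_group)
    also have "\<dots> = (A *\<^sub>v message_vec \<omega>) $ i"
      using i A by (auto simp: scalar_prod_def message_vec_def lessThan_atLeast0 intro!: sum.cong)
    finally show "finsum_vec TYPE('a) (dim_row A) (\<lambda>k. blocks L {k} A *\<^sub>v W k \<omega>) {1..M} $ i =
        (A *\<^sub>v message_vec \<omega>) $ i" .
  qed
qed

lemma message_vec_simple: "simple_function P message_vec"
proof -
  have "simple_function P (\<lambda>\<omega>. vec (M * L) (\<lambda>i. joint {1..M} W \<omega> (i div L + 1) $ (i mod L)))"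
    by (rule simple_function_compose1[OF simple_function_joint]) (auto intro: W_simple)
  moreover have "vec (M * L) (\<lambda>i. joint {1..M} W \<omega> (i div L + 1) $ (i mod L)) = message_vec \<omega>" for \<omega>
    unfolding message_vec_def
  proof (rule eq_vecI)
    fix i assume "i < dim_vec (vec (M * L) (\<lambda>i. W (i div L + 1) \<omega> $ (i mod L)))"
    then have "i < M * L" by simp
    then have "i div L + 1 \<in> {1..M}" by (simp add: less_mult_imp_div_less Suc_le_eq)
    then show "vec (M * L) (\<lambda>i. joint {1..M} W \<omega> (i div L + 1) $ (i mod L)) $ i =
        vec (M * L) (\<lambda>i. W (i div L + 1) \<omega> $ (i mod L)) $ i"
      using \<open>i < M * L\<close> by (simp add: joint_def)
  qed simp
  ultimately show ?thesis by simp
qed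

lemma X_simple:
  assumes "m \<in> {1..M}" "j \<in> {1..S}"
  shows "simple_function P (X m j)"
proof -
  have "simple_function P (\<lambda>\<omega>. (\<lambda>(a, v). a *\<^sub>v v) (Q m j \<omega>, message_vec \<omega>))"
    by (rule simple_function_compose1[OF simple_function_Pair])
      (use queries_simple[OF assms] message_vec_simple in auto)
  then show ?thesis
    by (rule simple_function_cong[THEN iffD1, rotated]) (simp add: X_eq_mult_message_vec[OF assms])
qed

text \<open>Given the query \<open>a\<close>, the response is uniform on the column space of
  \<open>a\<close>, because every value has as many preimages as the kernel has elements. All
  conditional probabilities are thus \<open>1 / CARD('a) ^ mat_rank a\<close>, with logarithm
  \<open>- mat_rank a\<close>.\<close>

lemma cond_entropy_X_Q:
  assumes m: "m \<in> {1..M}" and j: "j \<in> {1..S}"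
  shows "cond_entropy_rv P (real CARD('a)) (X m j) (Q m j) = (\<integral>\<omega>. real (mat_rank (Q m j \<omega>)) \<partial>P)"
proof -
  let ?p = "real CARD('a)"
  interpret information_space P ?p by (rule information_space)
  let ?Y = "\<lambda>\<omega>. (X m j \<omega>, Q m j \<omega>)"
  have XQ: "simple_function P ?Y" using X_simple[OF m j] queries_simple[OF m j] by (rule simple_function_Pair)
  have "prob (?Y -` {(x, a)} \<inter> space P) *
      log ?p (prob (?Y -` {(x, a)} \<inter> space P) / prob (Q m j -` {a} \<inter> space P)) =
      - (prob (?Y -` {(x, a)} \<inter> space P) * real (mat_rank a))"
    if xa: "(x, a) \<in> ?Y ` space P" for x a
  proof -
    obtain \<omega> where \<omega>: "\<omega> \<in> space P" "x = X m j \<omega>" "a = Q m j \<omega>" using xa by blast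
    have a: "a \<in> carrier_mat (dim_row a) (M * L)" using queries_dim[OF m j \<omega>(1)] \<omega>(3) by auto
    have x: "x = a *\<^sub>v message_vec \<omega>" using X_eq_mult_message_vec[OF m j \<omega>(1)] \<omega> by simp
    let ?B = "{v \<in> carrier_vec (M * L). a *\<^sub>v v = a *\<^sub>v message_vec \<omega>}"
    let ?K = "{v \<in> carrier_vec (M * L). a *\<^sub>v v = 0\<^sub>v (dim_row a)}"
    let ?q = "prob (Q m j -` {a} \<inter> space P)"
    have "?Y -` {(x, a)} \<inter> space P =
        joint {1..S} (Q m) -` {f. f j = a} \<inter> space P \<inter> {\<omega> \<in> space P. message_vec \<omega> \<in> ?B}"
      unfolding query_event[OF j, symmetric] x
      using X_eq_mult_message_vec[OF m j] message_vec_carrier by auto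
    then have "prob (?Y -` {(x, a)} \<inter> space P) = ?q * real (card ?B) / ?p ^ (M * L)"
      using prob_query_message(1)[OF m, of ?B "{f. f j = a}"] unfolding query_event[OF j] by auto
    also have "card ?B = card ?K" by (rule card_fibre_mult_mat_vec[OF a message_vec_carrier])
    also have "?p ^ (M * L) = ?p ^ mat_rank a * real (card ?K)"
      using card_kernel_rank[OF a] by (metis of_nat_mult of_nat_power)
    finally have joint: "prob (?Y -` {(x, a)} \<inter> space P) =
        ?q * real (card ?K) / (?p ^ mat_rank a * real (card ?K))" .
    have "card ?K \<noteq> 0"
    proof
      assume "card ?K = 0"
      then show False using card_kernel_rank[OF a] by simp
    qed
    then have joint: "prob (?Y -` {(x, a)} \<inter> space P) = ?q / ?p ^ mat_rank a" using joint by simp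
    \<comment> \<open>If the query has probability 0, the quotient inside the logarithm is a
      division by 0, but the factor in front vanishes as well.\<close>
    show ?thesis
    proof (cases "?q = 0")
      case False
      then have "prob (?Y -` {(x, a)} \<inter> space P) / ?q = 1 / ?p ^ mat_rank a" by (simp add: joint)
      then show ?thesis using b_gt_1 by (simp add: log_divide log_nat_power)
    qed (simp add: joint)
  qed
  then have "cond_entropy_rv P ?p (X m j) (Q m j) =
      - (\<Sum>(x, a)\<in>?Y ` space P. - (prob (?Y -` {(x, a)} \<inter> space P) * real (mat_rank a)))"
    unfolding cond_entropy_rv_eq[OF X_simple[OF m j] queries_simple[OF m j]]
    by (intro arg_cong[where f = uminus] sum.cong) auto
  also have "\<dots> = (\<Sum>y\<in>?Y ` space P. prob (?Y -` {y} \<inter> space P) * real (mat_rank (snd y)))"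
    by (simp add: case_prod_unfold sum_negf)
  also have "\<dots> = (\<integral>\<omega>. real (mat_rank (Q m j \<omega>)) \<partial>P)"
    using expectation_simple[OF XQ, of "\<lambda>y. real (mat_rank (snd y))"] by simp
  finally show ?thesis .
qed

text \<open>The message vectors 0 and \<open>u\<close> give the same answers to \<open>q\<close>,
  all zero. By independence each occurs together with \<open>q\<close> with positive probability, so
  correctness forces them to agree on block \<open>m\<close>.\<close>

lemma correct_imp_block_determined:
  assumes "correct" "m \<in> {1..M}" "realization m q"
    and u: "u \<in> carrier_vec (M * L)" "\<And>j. j \<in> {1..S} \<Longrightarrow> q j *\<^sub>v u = 0\<^sub>v (dim_row (q j))"
  shows "message_block m u = message_block m (0\<^sub>v (M * L))"
proof -
  note m = assms(2)
  interpret information_space P "real CARD('a)" by (rule information_space)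
  let ?F = "{f. \<forall>j\<in>{1..S}. f j = q j}"
  define E where "E v = joint {1..S} (Q m) -` ?F \<inter> space P \<inter> {\<omega> \<in> space P. message_vec \<omega> \<in> {v}}" for v
  have pos: "0 < prob (E v)" and ev: "E v \<in> events" if "v \<in> carrier_vec (M * L)" for v
    using prob_query_message[OF m, of "{v}" ?F] that assms(3) b_gt_1
    unfolding E_def realization_def realization_event by auto
  have E: "W m \<omega> = message_block m v \<and> (joint {1..S} (X m) \<omega>, joint {1..S} (Q m) \<omega>) =
      ((\<lambda>j\<in>{1..S}. 0\<^sub>v (dim_row (q j))), (\<lambda>j\<in>{1..S}. q j))"
    if v: "\<And>j. j \<in> {1..S} \<Longrightarrow> q j *\<^sub>v v = 0\<^sub>v (dim_row (q j))" and "\<omega> \<in> E v" for \<omega> v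
  proof -
    have \<omega>: "\<omega> \<in> space P" "message_vec \<omega> = v" "\<And>j. j \<in> {1..S} \<Longrightarrow> Q m j \<omega> = q j"
      using that(2) by (auto simp: E_def joint_def)
    have "X m j \<omega> = 0\<^sub>v (dim_row (q j))" if "j \<in> {1..S}" for j
      using X_eq_mult_message_vec[OF m that \<omega>(1)] \<omega>(2) \<omega>(3)[OF that] v[OF that] by simp
    then show ?thesis
      using \<omega> message_block_message_vec[OF m \<omega>(1)] by (auto simp: joint_def)
  qed
  \<comment> \<open>The width of the matrices in \<open>q\<close> is read off from an outcome that
    realizes them.\<close>
  have "E (0\<^sub>v (M * L)) \<noteq> {}" using pos[of "0\<^sub>v (M * L)"] by auto
  then obtain \<omega>0 where "\<omega>0 \<in> E (0\<^sub>v (M * L))" by blast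
  then have "\<omega>0 \<in> space P" "\<And>j. j \<in> {1..S} \<Longrightarrow> Q m j \<omega>0 = q j"
    by (auto simp: E_def joint_def)
  then have dim_q: "dim_col (q j) = M * L" if "j \<in> {1..S}" for j
    using queries_dim[OF m that] that by metis
  have "0\<^sub>v (M * L) \<in> common_kernel (M * L) q {1..S} {}"
    using dim_q by (rule zero_in_common_kernel)
  then have zero: "q j *\<^sub>v 0\<^sub>v (M * L) = 0\<^sub>v (dim_row (q j))" if "j \<in> {1..S}" for j
    using that by (simp add: common_kernel_def)
  have simple: "simple_function P (\<lambda>\<omega>. (joint {1..S} (X m) \<omega>, joint {1..S} (Q m) \<omega>))"
    by (intro simple_function_Pair simple_function_joint) (use X_simple[OF m] queries_simple[OF m] in auto)
  have H: "cond_entropy_rv P (real CARD('a)) (W m)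
       (\<lambda>\<omega>. (joint {1..S} (X m) \<omega>, joint {1..S} (Q m) \<omega>)) = 0"
    using assms(1) m by (simp add: correct_def)
  show ?thesis
    by (rule determined_if_cond_entropy_eq_0[OF W_simple[OF m] simple H pos pos ev ev E E])
      (use u zero in auto)
qed

subsection \<open>Expected ranks\<close>

definition mean_rank :: "nat \<Rightarrow> nat set \<Rightarrow> nat set \<Rightarrow> real" where
  "mean_rank m A I = (\<integral>\<omega>. block_rank M L (\<lambda>j. Q m j \<omega>) A I \<partial>P)"

text \<open>The last premise says that \<open>g\<close> depends on the queries of \<open>A\<close>
  only, so it factors through a random variable with finite range.\<close>

lemma integrable_queries:
  fixes g :: "(nat \<Rightarrow> 'a mat) \<Rightarrow> real"
  assumes "m \<in> {1..M}" "A \<subseteq> {1..S}" "\<And>q q'. (\<And>j. j \<in> A \<Longrightarrow> q j = q' j) \<Longrightarrow> g q = g q'"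
  shows "integrable P (\<lambda>\<omega>. g (\<lambda>j. Q m j \<omega>))"
proof -
  have "simple_function P (joint A (Q m))"
    using assms(1,2) finite_subset[OF assms(2)]
    by (intro simple_function_joint queries_simple) auto
  then have "integrable P (\<lambda>\<omega>. g (joint A (Q m) \<omega>))" by (rule integrable_simple)
  moreover have "g (joint A (Q m) \<omega>) = g (\<lambda>j. Q m j \<omega>)" for \<omega>
    by (rule assms(3)) (simp add: joint_def)
  ultimately show ?thesis by simp
qed

lemma integrable_block_rank:
  assumes "m \<in> {1..M}" "A \<subseteq> {1..S}"
  shows "integrable P (\<lambda>\<omega>. block_rank M L (\<lambda>j. Q m j \<omega>) A I)"
  using assms by (rule integrable_queries) (rule block_rank_cong)

lemma query_dim_col:
  assumes "m \<in> {1..M}" "A \<subseteq> {1..S}" "\<omega> \<in> space P" "j \<in> A"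
  shows "dim_col (Q m j \<omega>) = M * L"
  using assms(1) subsetD[OF assms(2,4)] assms(3) by (rule queries_dim)

lemma mean_rank_empty: "I \<subseteq> {1..M} \<Longrightarrow> mean_rank m {} I = 0"
  by (simp add: mean_rank_def block_rank_no_servers)

lemma mean_rank_no_messages:
  assumes "m \<in> {1..M}" "A \<subseteq> {1..S}"
  shows "mean_rank m A {} = 0"
proof -
  have "block_rank M L (\<lambda>j. Q m j \<omega>) A {} = 0" if "\<omega> \<in> space P" for \<omega>
  proof -
    let ?K = "common_kernel (M * L) (\<lambda>j. Q m j \<omega>) A (block_cols L {})"
    have "?K \<subseteq> {0\<^sub>v (M * L)}"
      by (auto simp: common_kernel_def supported_def block_cols_def)
    then have "card ?K \<le> card {0\<^sub>v (M * L) :: 'a vec}"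
      by (rule card_mono[rotated]) simp
    moreover have "0 < card ?K"
      using query_dim_col[OF assms that] by (rule card_common_kernel_pos)
    ultimately have "card ?K = 1" by simp
    then show ?thesis by (simp add: block_rank_def)
  qed
  then have "mean_rank m A {} = (\<integral>\<omega>. 0 \<partial>P)"
    unfolding mean_rank_def by (rule Bochner_Integration.integral_cong[OF refl])
  then show ?thesis by simp
qed

lemma mean_rank_mono:
  assumes "m \<in> {1..M}" "A \<subseteq> B" "B \<subseteq> {1..S}"
  shows "mean_rank m A I \<le> mean_rank m B I"
  unfolding mean_rank_def
proof (rule integral_mono)
  have A: "A \<subseteq> {1..S}" using assms(2,3) by blast
  show "integrable P (\<lambda>\<omega>. block_rank M L (\<lambda>j. Q m j \<omega>) A I)"
    using assms(1) A by (rule integrable_block_rank)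
  show "integrable P (\<lambda>\<omega>. block_rank M L (\<lambda>j. Q m j \<omega>) B I)"
    using assms(1,3) by (rule integrable_block_rank)
  show "block_rank M L (\<lambda>j. Q m j \<omega>) A I \<le> block_rank M L (\<lambda>j. Q m j \<omega>) B I" if "\<omega> \<in> space P" for \<omega>
    using assms(2) query_dim_col[OF assms(1,3) that] by (rule block_rank_mono)
qed

lemma mean_rank_submodular:
  assumes "m \<in> {1..M}" "I \<subseteq> {1..M}"
  shows "submodular_on {1..S} (\<lambda>A. mean_rank m A I)"
  unfolding submodular_on_def
proof (intro conjI allI impI)
  show "mean_rank m {} I = 0" using assms(2) by (rule mean_rank_empty)
  fix A B assume AB: "A \<subseteq> {1..S}" "B \<subseteq> {1..S}"
  have int: "integrable P (\<lambda>\<omega>. block_rank M L (\<lambda>j. Q m j \<omega>) C I)" if "C \<subseteq> {1..S}" for C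
    using assms(1) that by (rule integrable_block_rank)
  have "(\<integral>\<omega>. block_rank M L (\<lambda>j. Q m j \<omega>) (A \<union> B) I + block_rank M L (\<lambda>j. Q m j \<omega>) (A \<inter> B) I \<partial>P) \<le>
      (\<integral>\<omega>. block_rank M L (\<lambda>j. Q m j \<omega>) A I + block_rank M L (\<lambda>j. Q m j \<omega>) B I \<partial>P)"
    using assms(1) AB
    by (intro integral_mono Bochner_Integration.integrable_add int block_rank_submodular query_dim_col[of m "{1..S}"]) auto
  moreover have "A \<union> B \<subseteq> {1..S}" "A \<inter> B \<subseteq> {1..S}" using AB by auto
  ultimately show "mean_rank m (A \<union> B) I + mean_rank m (A \<inter> B) I \<le> mean_rank m A I + mean_rank m B I"
    unfolding mean_rank_def using AB by (simp add: int)
qed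

lemma mean_rank_diff_mono:
  assumes "m \<in> {1..M}" "A \<subseteq> B" "B \<subseteq> {1..S}" "I \<subseteq> J"
  shows "mean_rank m B I - mean_rank m A I \<le> mean_rank m B J - mean_rank m A J"
proof -
  have int: "integrable P (\<lambda>\<omega>. block_rank M L (\<lambda>j. Q m j \<omega>) C K)" if "C \<subseteq> {1..S}" for C K
    using assms(1) that by (rule integrable_block_rank)
  have A: "A \<subseteq> {1..S}" using assms by auto
  have "(\<integral>\<omega>. block_rank M L (\<lambda>j. Q m j \<omega>) B I - block_rank M L (\<lambda>j. Q m j \<omega>) A I \<partial>P) \<le>
      (\<integral>\<omega>. block_rank M L (\<lambda>j. Q m j \<omega>) B J - block_rank M L (\<lambda>j. Q m j \<omega>) A J \<partial>P)"
    using assms A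
    by (intro integral_mono Bochner_Integration.integrable_diff int block_rank_diff_mono query_dim_col[of m B]) auto
  then show ?thesis unfolding mean_rank_def using assms(3) A by (simp add: int)
qed

section \<open>Realizations as atoms of the query distribution\<close>

lemma realization_dim_col:
  assumes "m \<in> {1..M}" "realization m q" "j \<in> {1..S}"
  shows "dim_col (q j) = M * L"
proof -
  have "{\<omega> \<in> space P. \<forall>j\<in>{1..S}. Q m j \<omega> = q j} \<noteq> {}"
  proof
    assume "{\<omega> \<in> space P. \<forall>j\<in>{1..S}. Q m j \<omega> = q j} = {}"
    then show False using assms(2) unfolding realization_def by (simp only: measure_empty less_irrefl)
  qed
  then obtain \<omega> where "\<omega> \<in> space P" "\<forall>j\<in>{1..S}. Q m j \<omega> = q j" by blast
  then show ?thesis using queries_dim[OF assms(1,3), of \<omega>] assms(3) by simp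
qed

lemma AE_realization:
  assumes "m \<in> {1..M}"
  shows "AE \<omega> in P. realization m (\<lambda>j. Q m j \<omega>)"
proof -
  let ?J = "joint {1..S} (Q m)"
  have J: "simple_function P ?J"
    using assms by (intro simple_function_joint queries_simple) auto
  let ?N = "\<Union>f\<in>{f \<in> ?J ` space P. prob (?J -` {f} \<inter> space P) = 0}. ?J -` {f} \<inter> space P"
  have "?N \<in> null_sets P"
    using simple_functionD[OF J]
    by (intro null_sets_UN' countable_finite) (auto intro!: null_setsI simp: emeasure_eq_measure)
  moreover have "{\<omega> \<in> space P. \<not> realization m (\<lambda>j. Q m j \<omega>)} \<subseteq> ?N"
  proof clarify
    fix \<omega> assume \<omega>: "\<omega> \<in> space P" "\<not> realization m (\<lambda>j. Q m j \<omega>)"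
    have "{\<omega>' \<in> space P. \<forall>j\<in>{1..S}. Q m j \<omega>' = Q m j \<omega>} = ?J -` {?J \<omega>} \<inter> space P"
      by (auto simp: joint_eq_iff)
    then have "prob (?J -` {?J \<omega>} \<inter> space P) = 0"
      using \<omega>(2) by (simp add: realization_def zero_less_measure_iff)
    then show "\<omega> \<in> ?N" using \<omega>(1) by blast
  qed
  ultimately show ?thesis by (rule AE_I')
qed

text \<open>An almost sure property cannot fail on an event of positive probability. As
  \<open>realization\<close> fixes \<open>q\<close> on \<open>{1..S}\<close> only, \<open>G\<close>
  must not look beyond these servers.\<close>

lemma realization_if_AE:
  assumes "m \<in> {1..M}" "realization m q" "AE \<omega> in P. G (\<lambda>j. Q m j \<omega>)"
    and "\<And>q q'. (\<And>j. j \<in> {1..S} \<Longrightarrow> q j = q' j) \<Longrightarrow> G q = G q'"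
  shows "G q"
proof (rule ccontr)
  assume n: "\<not> G q"
  let ?E = "{\<omega> \<in> space P. \<forall>j\<in>{1..S}. Q m j \<omega> = q j}"
  have "AE \<omega> in P. \<omega> \<notin> ?E"
    using assms(3)
  proof eventually_elim
    fix \<omega> assume G: "G (\<lambda>j. Q m j \<omega>)"
    show "\<omega> \<notin> ?E"
    proof
      assume "\<omega> \<in> ?E"
      then have "G (\<lambda>j. Q m j \<omega>) = G q" by (intro assms(4)) simp
      then show False using G n by simp
    qed
  qed
  moreover have "?E \<in> events" unfolding realization_event using query_event_in_events[OF assms(1)] .
  ultimately have "prob ?E = 0" by (simp add: prob_eq_0)
  then show False using assms(2) by (simp add: realization_def)
qed

lemma correct_imp_block_rank_remove:
  assumes "correct" "I \<subseteq> {1..M}" "m \<in> I" "realization m q"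
  shows "block_rank M L q {1..S} I = real L + block_rank M L q {1..S} (I - {m})"
proof (rule block_rank_remove_determined_block[OF assms(2,3)])
  fix u :: "'a vec" and i
  assume u: "u \<in> carrier_vec (M * L)" "\<And>j. j \<in> {1..S} \<Longrightarrow> q j *\<^sub>v u = 0\<^sub>v (dim_row (q j))"
    and i: "i < M * L" "i div L + 1 = m"
  have m: "m \<in> {1..M}" using assms(2,3) by auto
  have L: "0 < L" using i(1) by (cases L) auto
  have "(m - 1) * L + i mod L = i" using i(2) by auto
  moreover have "message_block m u $ (i mod L) = message_block m (0\<^sub>v (M * L)) $ (i mod L)"
    using correct_imp_block_determined[OF assms(1) m assms(4) u] by simp
  ultimately show "u $ i = 0" using L i(1) by (simp add: message_block_def)
qed

lemma mean_rank_remove: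
  assumes "correct" "I \<subseteq> {1..M}" "m \<in> I"
  shows "mean_rank m {1..S} I = real L + mean_rank m {1..S} (I - {m})"
proof -
  have m: "m \<in> {1..M}" using assms(2,3) by auto
  have "mean_rank m {1..S} I =
      (\<integral>\<omega>. real L + block_rank M L (\<lambda>j. Q m j \<omega>) {1..S} (I - {m}) \<partial>P)"
    unfolding mean_rank_def
  proof (rule integral_cong_AE)
    show "AE \<omega> in P. block_rank M L (\<lambda>j. Q m j \<omega>) {1..S} I =
        real L + block_rank M L (\<lambda>j. Q m j \<omega>) {1..S} (I - {m})"
      using AE_realization[OF m]
      by eventually_elim (rule correct_imp_block_rank_remove[OF assms])
  qed (use integrable_block_rank[OF m] in \<open>auto intro!: borel_measurable_integrable borel_measurable_add\<close>)
  also have "\<dots> = real L + mean_rank m {1..S} (I - {m})"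
    unfolding mean_rank_def using integrable_block_rank[OF m, of "{1..S}" "I - {m}"]
    by (subst Bochner_Integration.integral_add) (auto simp: prob_space)
  finally show ?thesis .
qed

text \<open>Privacy speaks of exactly \<open>T\<close> servers. A smaller set \<open>A\<close> is
  enlarged to such a coalition \<open>B\<close>, and the expected rank of \<open>A\<close> is an
  integral against the law of the queries of \<open>B\<close>.\<close>

lemma mean_rank_private:
  assumes "colluding_private T" "T \<le> S" "m \<in> {1..M}" "m' \<in> {1..M}" "A \<subseteq> {1..S}" "card A \<le> T"
  shows "mean_rank m A I = mean_rank m' A I"
proof -
  obtain B where B: "A \<subseteq> B" "B \<subseteq> {1..S}" "card B = T"
    using exists_subset_between[of A T "{1..S}"] assms(2,5,6) by auto
  have "mean_rank m A I = (\<integral>q. block_rank M L q A I \<partial>distr P (count_space UNIV) (joint B (Q m)))"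
    if "m \<in> {1..M}" for m
  proof -
    have "simple_function P (joint B (Q m))"
      using B(2) that finite_subset[OF B(2)] by (intro simple_function_joint queries_simple) auto
    then have "joint B (Q m) \<in> measurable P (count_space UNIV)"
      by (rule measurable_simple_function)
    then have "(\<integral>q. block_rank M L q A I \<partial>distr P (count_space UNIV) (joint B (Q m))) =
        (\<integral>\<omega>. block_rank M L (joint B (Q m) \<omega>) A I \<partial>P)"
      by (rule integral_distr) simp
    also have "\<dots> = mean_rank m A I"
      unfolding mean_rank_def
      by (intro Bochner_Integration.integral_cong[OF refl] block_rank_cong) (use B(1) in \<open>auto simp: joint_def\<close>)
    finally show ?thesis ..
  qed
  moreover have "distr P (count_space UNIV) (joint B (Q m)) = distr P (count_space UNIV) (joint B (Q m'))"
    using assms(1,3,4) B(2,3) unfolding colluding_private_def by blast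
  ultimately show ?thesis using assms(3,4) by simp
qed

text \<open>The nonnegative \<open>g - f\<close> has mean 0, so it vanishes almost surely and hence
  at every atom. This is the passage from the capacity, a statement about expectations, to
  conditions on every realization.\<close>

lemma eq_on_realizations_if_mean_eq:
  fixes f g :: "(nat \<Rightarrow> 'a mat) \<Rightarrow> real"
  assumes m: "m \<in> {1..M}" and q: "realization m q"
    and cong: "\<And>q q'. (\<And>j. j \<in> {1..S} \<Longrightarrow> q j = q' j) \<Longrightarrow> f q = f q'"
      "\<And>q q'. (\<And>j. j \<in> {1..S} \<Longrightarrow> q j = q' j) \<Longrightarrow> g q = g q'"
    and le: "\<And>q. (\<And>j. j \<in> {1..S} \<Longrightarrow> dim_col (q j) = M * L) \<Longrightarrow> f q \<le> g q"
    and mean: "(\<integral>\<omega>. f (\<lambda>j. Q m j \<omega>) \<partial>P) = (\<integral>\<omega>. g (\<lambda>j. Q m j \<omega>) \<partial>P)"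
  shows "f q = g q"
proof -
  have int: "integrable P (\<lambda>\<omega>. f (\<lambda>j. Q m j \<omega>))" "integrable P (\<lambda>\<omega>. g (\<lambda>j. Q m j \<omega>))"
    using m by (rule integrable_queries[of m "{1..S}"]; use cong in blast)+
  have "AE \<omega> in P. g (\<lambda>j. Q m j \<omega>) - f (\<lambda>j. Q m j \<omega>) = 0"
  proof (subst integral_nonneg_eq_0_iff_AE[symmetric])
    show "integrable P (\<lambda>\<omega>. g (\<lambda>j. Q m j \<omega>) - f (\<lambda>j. Q m j \<omega>))" using int by simp
    show "AE \<omega> in P. 0 \<le> g (\<lambda>j. Q m j \<omega>) - f (\<lambda>j. Q m j \<omega>)"
      using le queries_dim[OF m] by (intro AE_I2) simp
    show "(\<integral>\<omega>. g (\<lambda>j. Q m j \<omega>) - f (\<lambda>j. Q m j \<omega>) \<partial>P) = 0" using int mean by simp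
  qed
  then have "g q - f q = 0"
    by (rule realization_if_AE[OF m q]) (use cong in metis)
  then show ?thesis by simp
qed

lemma integral_eq_if_realizations_eq:
  fixes f g :: "(nat \<Rightarrow> 'a mat) \<Rightarrow> real"
  assumes m: "m \<in> {1..M}" and eq: "\<And>q. realization m q \<Longrightarrow> f q = g q"
    and cong: "\<And>q q'. (\<And>j. j \<in> {1..S} \<Longrightarrow> q j = q' j) \<Longrightarrow> f q = f q'"
      "\<And>q q'. (\<And>j. j \<in> {1..S} \<Longrightarrow> q j = q' j) \<Longrightarrow> g q = g q'"
  shows "(\<integral>\<omega>. f (\<lambda>j. Q m j \<omega>) \<partial>P) = (\<integral>\<omega>. g (\<lambda>j. Q m j \<omega>) \<partial>P)"
proof (rule integral_cong_AE)
  have "integrable P (\<lambda>\<omega>. f (\<lambda>j. Q m j \<omega>))" "integrable P (\<lambda>\<omega>. g (\<lambda>j. Q m j \<omega>))"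
    using m by (rule integrable_queries[of m "{1..S}"]; use cong in blast)+
  then show "(\<lambda>\<omega>. f (\<lambda>j. Q m j \<omega>)) \<in> borel_measurable P" "(\<lambda>\<omega>. g (\<lambda>j. Q m j \<omega>)) \<in> borel_measurable P"
    by auto
  show "AE \<omega> in P. f (\<lambda>j. Q m j \<omega>) = g (\<lambda>j. Q m j \<omega>)"
    using AE_realization[OF m] by eventually_elim (rule eq)
qed

end

section \<open>The capacity of private schemes\<close>

text \<open>Slack in \<open>h A \<le> (\<Sum>i\<in>A. h {i})\<close> would carry over to
  \<open>U\<close> through \<open>h U \<le> h A + h (U - A)\<close>.\<close>

lemma submodular_on_modular:
  assumes "submodular_on U h" "finite U" "h U = (\<Sum>i\<in>U. h {i})" "A \<subseteq> U"
  shows "h A = (\<Sum>i\<in>A. h {i})"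
proof -
  have fin: "finite A" "finite (U - A)" using assms(2,4) finite_subset by auto
  have "A \<union> (U - A) = U" "A \<inter> (U - A) = {}" using assms(4) by auto
  then have "h U \<le> h A + h (U - A)"
    using submodular_onD[OF assms(1,4), of "U - A"] submodular_on_empty[OF assms(1)] by auto
  moreover have "h (U - A) \<le> (\<Sum>i\<in>U - A. h {i})"
    using assms(1) fin(2) by (rule submodular_on_le_sum) auto
  moreover have "h A \<le> (\<Sum>i\<in>A. h {i})" using assms(1) fin(1) assms(4) by (rule submodular_on_le_sum)
  moreover have "(\<Sum>i\<in>U. h {i}) = (\<Sum>i\<in>U - A. h {i}) + (\<Sum>i\<in>A. h {i})"
    using assms(4,2) by (rule sum.subset_diff)
  ultimately show ?thesis using assms(3) by linarith
qed

text \<open>This is Han's inequality for the negative of an additive function, which is submodular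
  too. It saves counting the subsets that contain a given element.\<close>

lemma sum_subsets_of_card_le:
  fixes a :: "'a \<Rightarrow> real"
  assumes "finite U" "1 \<le> k" "k \<le> card U"
  shows "real (card U) * (\<Sum>A\<in>subsets_of_card U k. \<Sum>i\<in>A. a i) \<le> real k * real (card U choose k) * (\<Sum>i\<in>U. a i)"
proof -
  have "submodular_on U (\<lambda>A. - (\<Sum>i\<in>A. a i))"
    unfolding submodular_on_def
  proof (intro conjI allI impI)
    fix A B assume "A \<subseteq> U" "B \<subseteq> U"
    then have "(\<Sum>i\<in>A \<union> B. a i) + (\<Sum>i\<in>A \<inter> B. a i) = (\<Sum>i\<in>A. a i) + (\<Sum>i\<in>B. a i)"
      using assms(1) by (intro sum.union_inter) (auto intro: finite_subset)
    then show "- (\<Sum>i\<in>A \<union> B. a i) + - (\<Sum>i\<in>A \<inter> B. a i) \<le> - (\<Sum>i\<in>A. a i) + - (\<Sum>i\<in>B. a i)" by linarith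
  qed simp
  from Han_inequality[OF this assms] show ?thesis by (simp add: sum_negf)
qed

lemma block_rank_submodular_on:
  assumes "\<And>j. j \<in> {1..S} \<Longrightarrow> dim_col (q j) = M * L" "I \<subseteq> {1..M}"
  shows "submodular_on {1..S} (\<lambda>A. block_rank M L q A I)"
  unfolding submodular_on_def
proof (intro conjI allI impI)
  show "block_rank M L q {} I = 0" using assms(2) by (rule block_rank_no_servers)
  show "block_rank M L q (A \<union> B) I + block_rank M L q (A \<inter> B) I \<le> block_rank M L q A I + block_rank M L q B I"
    if "A \<subseteq> {1..S}" "B \<subseteq> {1..S}" for A B
    by (rule block_rank_submodular) (use assms(1) that in blast)
qed

locale private_linear_scheme = linear_scheme P M S L W Q
  for P :: "'w measure" and M S L :: nat
    and W :: "nat \<Rightarrow> 'w \<Rightarrow> 'a::{field,finite} vec"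
    and Q :: "nat \<Rightarrow> nat \<Rightarrow> 'w \<Rightarrow> 'a mat" +
  fixes T :: nat
  assumes M_ge_2: "2 \<le> M" and L_pos: "1 \<le> L" and T_pos: "1 \<le> T" and T_less: "T < S"
    and correct: correct and colluding: "colluding_private T"
begin

abbreviation coalitions :: "nat set set" where
  "coalitions \<equiv> subsets_of_card {1..S} T"

abbreviation full_rank :: "nat \<Rightarrow> nat set \<Rightarrow> real" where
  "full_rank m I \<equiv> mean_rank m {1..S} I"

definition \<rho> :: real where "\<rho> = real T / real S"

text \<open>\<open>1 / geom M\<close> is the capacity; the recursion \<open>geom_Suc\<close> adds
  one message at a time.\<close>

definition geom :: "nat \<Rightarrow> real" where "geom k = (\<Sum>i<k. \<rho> ^ i)"

lemma \<rho>_pos: "0 < \<rho>" and \<rho>_less_1: "\<rho> < 1"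
  using T_pos T_less by (simp_all add: \<rho>_def)

lemma geom_Suc: "geom (Suc k) = 1 + \<rho> * geom k"
  by (simp add: geom_def sum.lessThan_Suc_shift sum_distrib_left del: sum.lessThan_Suc)

lemma geom_mult: "(1 - \<rho>) * geom k = 1 - \<rho> ^ k"
  unfolding geom_def by (rule one_diff_power_eq[symmetric])

lemma card_coalitions: "card coalitions = S choose T" "finite coalitions" "0 < S choose T"
  using T_less n_subsets[of "{1..S}" T] by (auto simp: zero_less_binomial_iff)

lemma sum_coalitions_const: "(\<Sum>A\<in>coalitions. c) = real (S choose T) * c"
  unfolding sum_constant card_coalitions(1) ..

lemma singleton_coalition: "j \<in> {1..S} \<Longrightarrow> m \<in> {1..M} \<Longrightarrow> m' \<in> {1..M} \<Longrightarrow> mean_rank m {j} I = mean_rank m' {j} I"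
  by (rule mean_rank_private[OF colluding]) (use T_pos T_less in auto)

lemma coalition_rank:
  "A \<in> coalitions \<Longrightarrow> m \<in> {1..M} \<Longrightarrow> m' \<in> {1..M} \<Longrightarrow> mean_rank m A I = mean_rank m' A I"
  by (rule mean_rank_private[OF colluding]) (use T_less in auto)

lemma coalition_le_full_rank: "A \<in> coalitions \<Longrightarrow> m \<in> {1..M} \<Longrightarrow> mean_rank m A I \<le> full_rank m I"
  by (rule mean_rank_mono) auto

section \<open>Change of request and the lower bound on the download\<close>

lemma Han_mean_rank:
  assumes "m \<in> {1..M}" "J \<subseteq> {1..M}"
  shows "\<rho> * real (S choose T) * full_rank m J \<le> (\<Sum>A\<in>coalitions. mean_rank m A J)"
  using Han_inequality[OF mean_rank_submodular[OF assms], of T] T_pos T_less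
  by (simp add: \<rho>_def field_simps)

lemma sum_coalitions_le:
  assumes "m \<in> {1..M}" "m' \<in> {1..M}"
  shows "(\<Sum>A\<in>coalitions. mean_rank m' A J) \<le> real (S choose T) * full_rank m J"
proof -
  have "(\<Sum>A\<in>coalitions. mean_rank m' A J) \<le> (\<Sum>A\<in>coalitions. full_rank m J)"
  proof (rule sum_mono)
    fix A assume A: "A \<in> coalitions"
    show "mean_rank m' A J \<le> full_rank m J"
      using coalition_rank[OF A assms, of J] coalition_le_full_rank[OF A assms(1), of J] by simp
  qed
  then show ?thesis unfolding sum_coalitions_const .
qed

text \<open>Han's inequality for the request \<open>m'\<close> bounds the coalition ranks from below
  on average. By privacy these are the coalition ranks for \<open>m\<close> as well, and there each
  is at most the full rank.\<close>

lemma full_rank_ge: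
  assumes "m \<in> {1..M}" "m' \<in> {1..M}" "J \<subseteq> {1..M}"
  shows "\<rho> * full_rank m' J \<le> full_rank m J"
proof -
  have "real (S choose T) * (\<rho> * full_rank m' J) \<le> real (S choose T) * full_rank m J"
    using Han_mean_rank[OF assms(2,3)] sum_coalitions_le[OF assms(1,2), of J] by (simp add: ac_simps)
  then show ?thesis using card_coalitions(3) by simp
qed

text \<open>A change of request from \<open>m'\<close> to \<open>m\<close> without loss leaves no
  slack in Han's inequality for \<open>m'\<close>, so its equality case applies to
  \<open>m'\<close>.\<close>

lemma tight_imp_sum_full_rank:
  assumes "m \<in> {1..M}" "m' \<in> {1..M}" "J \<subseteq> {1..M}" "full_rank m J \<le> \<rho> * full_rank m' J"
  shows "full_rank m' J = (\<Sum>j\<in>{1..S}. mean_rank m' {j} J)"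
proof (rule Han_equality[OF mean_rank_submodular[OF assms(2,3)]])
  have "(\<Sum>A\<in>coalitions. mean_rank m' A J) \<le> real (S choose T) * (\<rho> * full_rank m' J)"
    using sum_coalitions_le[OF assms(1,2), of J] assms(4) by (meson mult_left_mono of_nat_0_le_iff order_trans)
  then show "real (card {1..S}) * (\<Sum>A\<in>coalitions. mean_rank m' A J)
      \<le> real T * real (card {1..S} choose T) * full_rank m' J"
    using T_less by (simp add: \<rho>_def field_simps)
qed (use T_pos T_less in auto)

text \<open>The same tightness seen from \<open>m\<close>: the coalition ranks reach the full rank
  on average, and none exceeds it, so each one equals it.\<close>

lemma tight_imp_coalition_full_rank:
  assumes m: "m \<in> {1..M}" "m' \<in> {1..M}" "J \<subseteq> {1..M}" "full_rank m J \<le> \<rho> * full_rank m' J"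
    and A: "A \<in> coalitions"
  shows "mean_rank m A J = full_rank m J"
proof -
  have "real (S choose T) * full_rank m J \<le> real (S choose T) * (\<rho> * full_rank m' J)"
    using m(4) by (rule mult_left_mono) simp
  also have "\<dots> \<le> (\<Sum>A\<in>coalitions. mean_rank m' A J)"
    using Han_mean_rank[OF m(2,3)] by (simp add: ac_simps)
  also have "\<dots> = (\<Sum>A\<in>coalitions. mean_rank m A J)"
    by (rule sum.cong[OF refl]) (rule coalition_rank[OF _ m(2,1)])
  finally have le: "(\<Sum>A\<in>coalitions. full_rank m J - mean_rank m A J) \<le> 0"
    unfolding sum_subtractf sum_coalitions_const by simp
  have nonneg: "0 \<le> full_rank m J - mean_rank m A J" if "A \<in> coalitions" for A
    using coalition_le_full_rank[OF that m(1), of J] by simp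
  have zero: "(\<Sum>A\<in>coalitions. full_rank m J - mean_rank m A J) = 0"
    by (rule antisym[OF le sum_nonneg]) (rule nonneg)
  have "full_rank m J - mean_rank m A J = 0"
    by (rule sum_nonneg_0[OF card_coalitions(2) nonneg zero A])
  then show ?thesis by simp
qed

text \<open>Correctness splits off the block of the requested \<open>m\<close>, of rank
  \<open>L\<close>. The request then passes to some \<open>m'\<close> still in the set, at the cost
  of the factor \<open>\<rho>\<close>, so that the next block can be split off.\<close>

lemma full_rank_lower_bound:
  assumes "I \<subseteq> {1..M}" "m \<in> I"
  shows "real L * geom (card I) \<le> full_rank m I"
  using assms
proof (induction "card I" arbitrary: I m)
  case 0
  then show ?case by (auto simp: finite_subset)
next
  case (Suc k)
  have fin: "finite I" using Suc.prems(1) finite_subset by blast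
  have m: "m \<in> {1..M}" and sub: "I - {m} \<subseteq> {1..M}" using Suc.prems by auto
  have k: "k = card (I - {m})" using Suc.hyps(2) Suc.prems(2) fin by simp
  have "\<rho> * (real L * geom k) \<le> full_rank m (I - {m})"
  proof (cases "I - {m} = {}")
    case True
    have "k = 0" using k unfolding True by simp
    then show ?thesis unfolding True using m by (simp add: geom_def mean_rank_no_messages)
  next
    case False
    then obtain m' where m': "m' \<in> I - {m}" by blast
    have "real L * geom k \<le> full_rank m' (I - {m})"
      using Suc.hyps(1)[OF k sub m'] k by simp
    then have "\<rho> * (real L * geom k) \<le> \<rho> * full_rank m' (I - {m})"
      using \<rho>_pos by (intro mult_left_mono) auto
    also have "\<dots> \<le> full_rank m (I - {m})"
      using m' sub by (intro full_rank_ge m) auto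
    finally show ?thesis .
  qed
  then show ?case
    using mean_rank_remove[OF correct Suc.prems] Suc.hyps(2)[symmetric]
    by (simp add: geom_Suc algebra_simps)
qed

text \<open>Message 1 stands for any request: by \<open>singleton_coalition\<close> the expected
  rank of a single server is the same for all of them.\<close>

definition download :: real where
  "download = (\<Sum>j\<in>{1..S}. mean_rank 1 {j} {1..M})"

lemma sum_singletons:
  assumes "m \<in> {1..M}" "A \<subseteq> {1..S}"
  shows "(\<Sum>j\<in>A. mean_rank m {j} I) = (\<Sum>j\<in>A. mean_rank 1 {j} I)"
  by (intro sum.cong refl singleton_coalition) (use assms M_ge_2 in auto)

lemma full_rank_le_sum:
  assumes "m \<in> {1..M}" "I \<subseteq> {1..M}"
  shows "full_rank m I \<le> (\<Sum>j\<in>{1..S}. mean_rank m {j} I)"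
  using mean_rank_submodular[OF assms] by (rule submodular_on_le_sum) auto

lemma download_lower_bound: "real L * geom M \<le> download"
proof -
  have 1: "1 \<in> {1..M}" using M_ge_2 by simp
  have "real L * geom M \<le> full_rank 1 {1..M}"
    using full_rank_lower_bound[OF subset_refl 1] by simp
  also have "\<dots> \<le> download" unfolding download_def using 1 by (intro full_rank_le_sum) auto
  finally show ?thesis .
qed

lemma geom_ge_1: "1 \<le> k \<Longrightarrow> 1 \<le> geom k"
proof -
  assume "1 \<le> k"
  then obtain l where "k = Suc l" by (cases k) auto
  moreover have "0 \<le> geom l" unfolding geom_def using \<rho>_pos by (intro sum_nonneg) simp
  ultimately show "1 \<le> geom k" using \<rho>_pos by (simp add: geom_Suc)
qed

lemma rate_eq: "rate = real L / download"
proof -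
  have "(\<Sum>i = 1..S. cond_entropy_rv P (real CARD('a)) (X m i) (Q m i)) = download"
    if m: "m \<in> {1..M}" for m
  proof -
    have "cond_entropy_rv P (real CARD('a)) (X m i) (Q m i) = mean_rank m {i} {1..M}"
      if i: "i \<in> {1..S}" for i
    proof -
      have "real (mat_rank (Q m i \<omega>)) = block_rank M L (\<lambda>j. Q m j \<omega>) {i} {1..M}" if "\<omega> \<in> space P" for \<omega>
        by (rule mat_rank_eq_block_rank) (rule queries_dim[OF m i that])
      then show ?thesis
        unfolding cond_entropy_X_Q[OF m i] mean_rank_def
        by (rule Bochner_Integration.integral_cong[OF refl])
    qed
    then have "(\<Sum>i = 1..S. cond_entropy_rv P (real CARD('a)) (X m i) (Q m i)) =
        (\<Sum>i = 1..S. mean_rank m {i} {1..M})"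
      by (rule sum.cong[OF refl])
    then show ?thesis unfolding download_def sum_singletons[OF m subset_refl] .
  qed
  then have "(\<lambda>m. entropy_rv P (real CARD('a)) (W m) /
      (\<Sum>i = 1..S. cond_entropy_rv P (real CARD('a)) (X m i) (Q m i))) ` {1..M} =
      (\<lambda>m. real L / download) ` {1..M}"
    using messages_entropy by (intro image_cong) simp_all
  also have "\<dots> = {real L / download}" using M_ge_2 by (simp add: image_constant_conv)
  finally show ?thesis by (simp add: rate_def)
qed

lemma capacity_iff_download:
  "rate = (1 - real T / real S) / (1 - (real T / real S) ^ M) \<longleftrightarrow> download = real L * geom M"
proof -
  have g: "1 \<le> geom M" using M_ge_2 by (intro geom_ge_1) simp
  have "0 < real L * geom M" using g L_pos by simp
  then have d: "0 < download" using download_lower_bound by linarith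
  have "1 - \<rho> \<noteq> 0" using \<rho>_less_1 by simp
  have "(1 - \<rho>) / (1 - \<rho> ^ M) = 1 / geom M"
    using \<open>1 - \<rho> \<noteq> 0\<close> by (simp add: geom_mult[symmetric])
  then have "rate = (1 - real T / real S) / (1 - (real T / real S) ^ M) \<longleftrightarrow> real L / download = 1 / geom M"
    unfolding rate_eq \<rho>_def by simp
  also have "\<dots> \<longleftrightarrow> download = real L * geom M"
    using d g by (auto simp: field_simps)
  finally show ?thesis .
qed

section \<open>Consequences of attaining the bound\<close>

context
  assumes optimal: "download = real L * geom M"
begin

text \<open>Downward induction from the set of all messages, where the rank is squeezed between the
  lower bound and the download. To descend to \<open>I\<close>, a message \<open>x\<close> outside
  is added and requested; splitting off its block yields the rank of \<open>I\<close> for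
  \<open>x\<close>, and changing the request from \<open>m\<close> to \<open>x\<close> turns this
  into an upper bound for \<open>m\<close>.\<close>

lemma optimal_full_rank:
  assumes "I \<subseteq> {1..M}" "m \<in> I"
  shows "full_rank m I = real L * geom (card I)"
  using assms
proof (induction "M - card I" arbitrary: I m)
  case 0
  have "card I \<le> M" using card_mono[OF _ 0(2)] by simp
  then have "I = {1..M}" using 0 by (intro card_subset_eq) auto
  moreover have m: "m \<in> {1..M}" using 0 by auto
  moreover have "full_rank m {1..M} \<le> download"
    unfolding download_def sum_singletons[OF m subset_refl, symmetric]
    using m by (intro full_rank_le_sum) auto
  ultimately show ?case using full_rank_lower_bound[OF 0(2,3)] optimal by simp
next
  case (Suc n)
  have "I \<noteq> {1..M}" using Suc.hyps(2) by auto
  then obtain x where x: "x \<in> {1..M}" "x \<notin> I" using Suc.prems by blast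
  have fin: "finite I" using Suc.prems(1) finite_subset by blast
  have m: "m \<in> {1..M}" using Suc.prems by blast
  have c: "card (insert x I) = Suc (card I)" using x fin by simp
  have sub: "insert x I \<subseteq> {1..M}" using x Suc.prems by simp
  have "full_rank x (insert x I) = real L * geom (card (insert x I))"
    using Suc.hyps(2) c x sub by (intro Suc.hyps(1)) auto
  moreover have "insert x I - {x} = I" using x by simp
  ultimately have "full_rank x I = \<rho> * (real L * geom (card I))"
    using mean_rank_remove[OF correct sub, of x] unfolding c geom_Suc by (simp add: algebra_simps)
  then have "\<rho> * full_rank m I \<le> \<rho> * (real L * geom (card I))"
    using full_rank_ge[OF x(1) m Suc.prems(1)] by simp
  then have "full_rank m I \<le> real L * geom (card I)" using \<rho>_pos by simp
  then show ?case using full_rank_lower_bound[OF Suc.prems] by simp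
qed

text \<open>Both sides are now known: splitting off \<open>x\<close> from \<open>insert x I\<close>
  leaves \<open>real L * (geom (Suc (card I)) - 1)\<close>, which is
  \<open>\<rho> * real L * geom (card I)\<close>. No change to a request outside \<open>I\<close>
  has slack.\<close>

lemma optimal_tight:
  assumes "I \<subseteq> {1..M}" "m \<in> I" "x \<in> {1..M}" "x \<notin> I"
  shows "full_rank x I \<le> \<rho> * full_rank m I"
proof -
  have "card (insert x I) = Suc (card I)" using assms finite_subset by fastforce
  then have "full_rank x (insert x I) = real L * geom (Suc (card I))"
    using optimal_full_rank[of "insert x I" x] assms by simp
  moreover have "full_rank x (insert x I) = real L + full_rank x I"
    using mean_rank_remove[OF correct, of "insert x I" x] assms by simp
  ultimately show ?thesis
    using optimal_full_rank[OF assms(1,2)] by (simp add: geom_Suc algebra_simps)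
qed

text \<open>For a proper subset, a message outside provides a tight change of request. The set of
  all messages has none, but there the sum is the download itself.\<close>

lemma optimal_full_rank_eq_sum:
  assumes "I \<subseteq> {1..M}" "m \<in> I"
  shows "full_rank m I = (\<Sum>j\<in>{1..S}. mean_rank m {j} I)"
proof (cases "I = {1..M}")
  case True
  have m: "m \<in> {1..M}" using assms by blast
  have "full_rank m {1..M} = download" using optimal_full_rank[OF assms] optimal True by simp
  then show ?thesis unfolding True download_def sum_singletons[OF m subset_refl] .
next
  case False
  then obtain x where x: "x \<in> {1..M}" "x \<notin> I" using assms by blast
  have m: "m \<in> {1..M}" using assms by blast
  show ?thesis
    using tight_imp_sum_full_rank[OF x(1) m assms(1) optimal_tight[OF assms x]] .
qed

text \<open>The sum formula for full ranks is known only for requests inside the set of messages,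
  and \<open>x\<close> is not in \<open>J\<close>. It is used for some \<open>m\<close> in
  \<open>J\<close>, restricted to the coalition, and carried over to \<open>x\<close> by privacy of
  the coalition and of the single servers.\<close>

lemma optimal_coalition:
  assumes "A \<in> coalitions" "x \<in> {1..M}"
  defines "J \<equiv> {1..M} - {x}"
  shows "mean_rank x A J = full_rank x J" "mean_rank x A J = (\<Sum>j\<in>A. mean_rank x {j} J)"
proof -
  have "\<exists>m. m \<in> {1..M} \<and> m \<noteq> x" using M_ge_2 by (intro exI[of _ "if x = 1 then 2 else 1"]) auto
  then obtain m where m: "m \<in> J" "m \<in> {1..M}" by (auto simp: J_def)
  have J: "J \<subseteq> {1..M}" "x \<notin> J" by (auto simp: J_def)
  show "mean_rank x A J = full_rank x J"
    by (rule tight_imp_coalition_full_rank[OF assms(2) m(2) J(1) optimal_tight[OF J(1) m(1) assms(2) J(2)] assms(1)])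
  have A: "A \<subseteq> {1..S}" using assms(1) by blast
  have "mean_rank x A J = mean_rank m A J" using assms(1,2) m(2) by (rule coalition_rank)
  also have "\<dots> = (\<Sum>j\<in>A. mean_rank m {j} J)"
    by (rule submodular_on_modular[OF mean_rank_submodular[OF m(2) J(1)] _ optimal_full_rank_eq_sum[OF J(1) m(1)] A]) simp
  also have "\<dots> = (\<Sum>j\<in>A. mean_rank x {j} J)"
    by (simp only: sum_singletons[OF m(2) A] sum_singletons[OF assms(2) A])
  finally show "mean_rank x A J = (\<Sum>j\<in>A. mean_rank x {j} J)" .
qed

end

section \<open>From expectations to conditions on realizations\<close>

lemma integral_sum_block_rank:
  assumes "m \<in> {1..M}" "A \<subseteq> {1..S}"
  shows "(\<integral>\<omega>. (\<Sum>j\<in>A. block_rank M L (\<lambda>j. Q m j \<omega>) {j} I) \<partial>P) = (\<Sum>j\<in>A. mean_rank m {j} I)"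
  unfolding mean_rank_def using assms
  by (intro Bochner_Integration.integral_sum integrable_block_rank) auto

lemma sum_block_rank_cong:
  "(\<And>j. j \<in> A \<Longrightarrow> q j = q' j) \<Longrightarrow> (\<Sum>j\<in>A. block_rank M L q {j} I) = (\<Sum>j\<in>A. block_rank M L q' {j} I)"
  by (intro sum.cong refl block_rank_cong) simp

text \<open>The conditions (1) and (2) of the theorem, in terms of kernels.\<close>

definition decoupled :: bool where
  "decoupled \<longleftrightarrow> (\<forall>m\<in>{1..M}. \<forall>q. realization m q \<longrightarrow> (\<forall>I. m \<in> I \<and> I \<subseteq> {1..M} \<longrightarrow>
    block_rank M L q {1..S} I = (\<Sum>j\<in>{1..S}. block_rank M L q {j} I)))"

definition aligned :: bool where
  "aligned \<longleftrightarrow> (\<forall>A\<in>coalitions. \<forall>m\<in>{1..M}. \<forall>q. realization m q \<longrightarrow>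
    block_rank M L q {1..S} ({1..M} - {m}) = (\<Sum>j\<in>A. block_rank M L q {j} ({1..M} - {m})))"

lemma optimal_imp_decoupled:
  assumes "download = real L * geom M"
  shows decoupled
  unfolding decoupled_def
proof (intro ballI allI impI)
  fix m q I assume m: "m \<in> {1..M}" and q: "realization m q" and I: "m \<in> I \<and> I \<subseteq> {1..M}"
  show "block_rank M L q {1..S} I = (\<Sum>j\<in>{1..S}. block_rank M L q {j} I)"
  proof (rule eq_on_realizations_if_mean_eq[OF m q])
    show "(\<integral>\<omega>. block_rank M L (\<lambda>j. Q m j \<omega>) {1..S} I \<partial>P) =
        (\<integral>\<omega>. (\<Sum>j\<in>{1..S}. block_rank M L (\<lambda>j. Q m j \<omega>) {j} I) \<partial>P)"
      unfolding integral_sum_block_rank[OF m subset_refl]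
      using optimal_full_rank_eq_sum[OF assms, of I m] I by (simp add: mean_rank_def)
    show "block_rank M L q {1..S} I \<le> (\<Sum>j\<in>{1..S}. block_rank M L q {j} I)"
      if "\<And>j. j \<in> {1..S} \<Longrightarrow> dim_col (q j) = M * L" for q :: "nat \<Rightarrow> 'a mat"
      by (rule submodular_on_le_sum[OF block_rank_submodular_on[OF that]]) (use I in auto)
  qed (rule block_rank_cong sum_block_rank_cong; blast)+
qed

lemma optimal_imp_aligned:
  assumes "download = real L * geom M"
  shows aligned
  unfolding aligned_def
proof (intro ballI allI impI)
  fix A m q assume A: "A \<in> coalitions" and m: "m \<in> {1..M}" and q: "realization m q"
  let ?J = "{1..M} - {m}"
  have sub: "A \<subseteq> {1..S}" using A by blast
  \<comment> \<open>Submodularity and monotonicity do not order the rank over all servers and the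
    sum over \<open>A\<close> at a single realization. The rank of \<open>A\<close> is at most
    either of them, so the equality is split there into two that can be read off from means.\<close>
  have "block_rank M L q A ?J = block_rank M L q {1..S} ?J"
  proof (rule eq_on_realizations_if_mean_eq[OF m q])
    show "(\<integral>\<omega>. block_rank M L (\<lambda>j. Q m j \<omega>) A ?J \<partial>P) =
        (\<integral>\<omega>. block_rank M L (\<lambda>j. Q m j \<omega>) {1..S} ?J \<partial>P)"
      using optimal_coalition(1)[OF assms A m] by (simp only: mean_rank_def)
    show "block_rank M L q A ?J \<le> block_rank M L q {1..S} ?J"
      if "\<And>j. j \<in> {1..S} \<Longrightarrow> dim_col (q j) = M * L" for q :: "nat \<Rightarrow> 'a mat"
      using sub that by (rule block_rank_mono)
  qed (rule block_rank_cong; use sub in blast)+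
  moreover have "block_rank M L q A ?J = (\<Sum>j\<in>A. block_rank M L q {j} ?J)"
  proof (rule eq_on_realizations_if_mean_eq[OF m q])
    show "(\<integral>\<omega>. block_rank M L (\<lambda>j. Q m j \<omega>) A ?J \<partial>P) =
        (\<integral>\<omega>. (\<Sum>j\<in>A. block_rank M L (\<lambda>j. Q m j \<omega>) {j} ?J) \<partial>P)"
      unfolding integral_sum_block_rank[OF m sub]
      using optimal_coalition(2)[OF assms A m] by (simp only: mean_rank_def)
    show "block_rank M L q A ?J \<le> (\<Sum>j\<in>A. block_rank M L q {j} ?J)"
      if "\<And>j. j \<in> {1..S} \<Longrightarrow> dim_col (q j) = M * L" for q :: "nat \<Rightarrow> 'a mat"
      by (rule submodular_on_le_sum[OF block_rank_submodular_on[OF that]])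
        (use sub finite_subset[OF sub] in auto)
  qed (rule block_rank_cong sum_block_rank_cong; use sub in blast)+
  ultimately show "block_rank M L q {1..S} ?J = (\<Sum>j\<in>A. block_rank M L q {j} ?J)" by simp
qed

section \<open>Sufficiency of the two conditions\<close>

context
  assumes decoupled: decoupled and aligned: aligned
begin

lemma decoupled_full_rank:
  assumes "m \<in> I" "I \<subseteq> {1..M}"
  shows "full_rank m I = (\<Sum>j\<in>{1..S}. mean_rank m {j} I)"
proof -
  have m: "m \<in> {1..M}" using assms by blast
  show ?thesis
    unfolding integral_sum_block_rank[OF m subset_refl, symmetric]
    unfolding mean_rank_def
  proof (rule integral_eq_if_realizations_eq[OF m])
    show "block_rank M L q {1..S} I = (\<Sum>j\<in>{1..S}. block_rank M L q {j} I)" if "realization m q" for q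
      using decoupled m that assms by (simp add: decoupled_def)
  qed (rule block_rank_cong sum_block_rank_cong; blast)+
qed

lemma aligned_full_rank:
  assumes A: "A \<in> coalitions" and m: "m \<in> {1..M}"
  shows "full_rank m ({1..M} - {m}) = (\<Sum>j\<in>A. mean_rank m {j} ({1..M} - {m}))"
proof -
  have sub: "A \<subseteq> {1..S}" using A by blast
  show ?thesis
    unfolding integral_sum_block_rank[OF m sub, symmetric]
    unfolding mean_rank_def
  proof (rule integral_eq_if_realizations_eq[OF m])
    show "block_rank M L q {1..S} ({1..M} - {m}) = (\<Sum>j\<in>A. block_rank M L q {j} ({1..M} - {m}))"
      if "realization m q" for q
      using aligned m that A unfolding aligned_def by blast
  qed (rule block_rank_cong sum_block_rank_cong; use sub in blast)+
qed

text \<open>Condition (2) bounds the rank for \<open>x\<close> by a sum of ranks that might exceed the rank of the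
  coalition. Condition (1) for another message \<open>m\<close>, transferred by privacy, excludes this.\<close>

lemma full_rank_le_coalition:
  assumes A: "A \<in> coalitions" and x: "x \<in> {1..M}" and J: "J \<subseteq> {1..M} - {x}"
  shows "full_rank x J \<le> (\<Sum>j\<in>A. mean_rank x {j} J)"
proof -
  let ?K = "{1..M} - {x}"
  have sub: "A \<subseteq> {1..S}" using A by blast
  have K: "?K \<subseteq> {1..M}" by blast
  have "\<exists>m. m \<in> {1..M} \<and> m \<noteq> x" using M_ge_2 by (intro exI[of _ "if x = 1 then 2 else 1"]) auto
  then obtain m where m: "m \<in> ?K" "m \<in> {1..M}" by auto
  have "mean_rank x A ?K = mean_rank m A ?K" using A x m(2) by (rule coalition_rank)
  also have "\<dots> = (\<Sum>j\<in>A. mean_rank m {j} ?K)"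
    by (rule submodular_on_modular[OF mean_rank_submodular[OF m(2) K] _ decoupled_full_rank[OF m(1) K] sub]) simp
  also have "\<dots> = (\<Sum>j\<in>A. mean_rank x {j} ?K)"
    by (simp only: sum_singletons[OF m(2) sub] sum_singletons[OF x sub])
  also have "\<dots> = full_rank x ?K" using aligned_full_rank[OF A x] by simp
  \<comment> \<open>The servers outside \<open>A\<close> add nothing over \<open>?K\<close>; by
    \<open>mean_rank_diff_mono\<close> they add nothing over the smaller \<open>J\<close>
    either.\<close>
  finally have "full_rank x J \<le> mean_rank x A J"
    using mean_rank_diff_mono[OF x sub subset_refl J] by simp
  also have "\<dots> \<le> (\<Sum>j\<in>A. mean_rank x {j} J)"
    by (rule submodular_on_le_sum[OF mean_rank_submodular[OF x]]) (use J sub finite_subset[OF sub] in auto)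
  finally show ?thesis .
qed

text \<open>The bound is averaged over all coalitions; each server belongs to the fraction
  \<open>T / S\<close> of them.\<close>

lemma full_rank_le_fraction:
  assumes x: "x \<in> {1..M}" and J: "J \<subseteq> {1..M} - {x}"
  shows "full_rank x J \<le> \<rho> * (\<Sum>j\<in>{1..S}. mean_rank x {j} J)"
proof -
  have "real (S choose T) * full_rank x J = (\<Sum>A\<in>coalitions. full_rank x J)"
    by (rule sum_coalitions_const[symmetric])
  also have "\<dots> \<le> (\<Sum>A\<in>coalitions. \<Sum>j\<in>A. mean_rank x {j} J)"
    by (rule sum_mono) (rule full_rank_le_coalition[OF _ x J])
  finally have "real S * (real (S choose T) * full_rank x J) \<le>
      real S * (\<Sum>A\<in>coalitions. \<Sum>j\<in>A. mean_rank x {j} J)"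
    by (rule mult_left_mono) simp
  also have "\<dots> \<le> real T * real (S choose T) * (\<Sum>j\<in>{1..S}. mean_rank x {j} J)"
    using sum_subsets_of_card_le[of "{1..S}" T "\<lambda>j. mean_rank x {j} J"] T_pos T_less by simp
  finally have "real (S choose T) * (real S * full_rank x J) \<le>
      real (S choose T) * (real T * (\<Sum>j\<in>{1..S}. mean_rank x {j} J))"
    by (simp only: ac_simps)
  then have "real S * full_rank x J \<le> real T * (\<Sum>j\<in>{1..S}. mean_rank x {j} J)"
    using card_coalitions(3) by simp
  then show ?thesis using T_less by (simp add: \<rho>_def field_simps)
qed

text \<open>The recursion of the lower bound with reversed inequalities: (1) turns the sum into the
  full rank for a request \<open>m\<close> in \<open>I\<close>, correctness splits off
  \<open>L\<close>, and the rest is at most \<open>\<rho>\<close> times the sum for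
  \<open>I - {m}\<close>. The induction closes because sums over single servers agree for all
  requests.\<close>

lemma sum_singletons_upper_bound:
  assumes "I \<subseteq> {1..M}"
  shows "(\<Sum>j\<in>{1..S}. mean_rank 1 {j} I) \<le> real L * geom (card I)"
  using assms
proof (induction "card I" arbitrary: I)
  case 0
  then have "I = {}" using finite_subset by fastforce
  then show ?case using M_ge_2 by (simp add: mean_rank_no_messages geom_def)
next
  case (Suc k)
  then obtain m where mI: "m \<in> I" by fastforce
  then have m: "m \<in> {1..M}" and k: "k = card (I - {m})"
    using Suc finite_subset[OF Suc.prems] by auto
  have "(\<Sum>j\<in>{1..S}. mean_rank 1 {j} I) = full_rank m I"
    unfolding decoupled_full_rank[OF mI Suc.prems] using sum_singletons[OF m subset_refl] by simp
  also have "\<dots> = real L + full_rank m (I - {m})" using correct Suc.prems mI by (rule mean_rank_remove)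
  also have "full_rank m (I - {m}) \<le> \<rho> * (\<Sum>j\<in>{1..S}. mean_rank m {j} (I - {m}))"
    using Suc.prems by (intro full_rank_le_fraction m) auto
  also have "(\<Sum>j\<in>{1..S}. mean_rank m {j} (I - {m})) = (\<Sum>j\<in>{1..S}. mean_rank 1 {j} (I - {m}))"
    by (rule sum_singletons[OF m subset_refl])
  also have "\<rho> * \<dots> \<le> \<rho> * (real L * geom k)"
  proof (rule mult_left_mono)
    have "I - {m} \<subseteq> {1..M}" using Suc.prems by blast
    from Suc.hyps(1)[OF k this]
    show "(\<Sum>j\<in>{1..S}. mean_rank 1 {j} (I - {m})) \<le> real L * geom k" unfolding k .
  qed (use \<rho>_pos in simp)
  finally show ?case unfolding Suc.hyps(2)[symmetric] geom_Suc by (simp add: algebra_simps)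
qed

lemma decoupled_aligned_imp_optimal: "download = real L * geom M"
  using sum_singletons_upper_bound[of "{1..M}"] download_lower_bound by (simp add: download_def)

end

section \<open>The conditions as ranks of matrices\<close>

lemma decoupled_iff:
  "decoupled \<longleftrightarrow> (\<forall>m\<in>{1..M}. \<forall>q. realization m q \<longrightarrow> (\<forall>I'. I' \<subseteq> {1..M} - {m} \<longrightarrow>
    (let I = {1..M} - I' in mat_rank (stack S (\<lambda>j. blocks L I (q j))) =
      (\<Sum>j = 1..S. mat_rank (blocks L I (q j))))))"
proof -
  have S: "1 \<le> S" using T_less by simp
  have eq: "mat_rank (stack S (\<lambda>j. blocks L I (q j))) = (\<Sum>j = 1..S. mat_rank (blocks L I (q j))) \<longleftrightarrow>
      block_rank M L q {1..S} I = (\<Sum>j\<in>{1..S}. block_rank M L q {j} I)"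
    if m: "m \<in> {1..M}" and q: "realization m q" and I: "I \<subseteq> {1..M}" for m q I
  proof -
    note dim = realization_dim_col[OF m q]
    have "real (\<Sum>j = 1..S. mat_rank (blocks L I (q j))) = (\<Sum>j\<in>{1..S}. block_rank M L q {j} I)"
      unfolding of_nat_sum by (rule sum.cong[OF refl]) (rule mat_rank_blocks[OF I dim])
    moreover have "real (mat_rank (stack S (\<lambda>j. blocks L I (q j)))) = block_rank M L q {1..S} I"
      by (rule mat_rank_stack_blocks[OF S I dim])
    ultimately show ?thesis by (metis of_nat_eq_iff)
  qed
  show ?thesis
    unfolding decoupled_def Let_def
  proof (intro ball_cong all_cong refl iffI allI impI)
    fix m q I'
    assume m: "m \<in> {1..M}" and q: "realization m q" and I': "I' \<subseteq> {1..M} - {m}"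
      and *: "\<forall>I. m \<in> I \<and> I \<subseteq> {1..M} \<longrightarrow> block_rank M L q {1..S} I = (\<Sum>j\<in>{1..S}. block_rank M L q {j} I)"
    \<comment> \<open>Complementation in \<open>{1..M}\<close> exchanges the sets \<open>I'\<close>
      avoiding \<open>m\<close> with the sets \<open>I\<close> containing \<open>m\<close>.\<close>
    have "m \<in> {1..M} - I' \<and> {1..M} - I' \<subseteq> {1..M}" using m I' by blast
    then show "mat_rank (stack S (\<lambda>j. blocks L ({1..M} - I') (q j))) =
        (\<Sum>j = 1..S. mat_rank (blocks L ({1..M} - I') (q j)))"
      using * eq[OF m q] by blast
  next
    fix m q I
    assume m: "m \<in> {1..M}" and q: "realization m q" and I: "m \<in> I \<and> I \<subseteq> {1..M}"
      and *: "\<forall>I'. I' \<subseteq> {1..M} - {m} \<longrightarrow> mat_rank (stack S (\<lambda>j. blocks L ({1..M} - I') (q j))) =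
        (\<Sum>j = 1..S. mat_rank (blocks L ({1..M} - I') (q j)))"
    have "{1..M} - I \<subseteq> {1..M} - {m}" "{1..M} - ({1..M} - I) = I" using I by auto
    then show "block_rank M L q {1..S} I = (\<Sum>j\<in>{1..S}. block_rank M L q {j} I)"
      using *[rule_format, of "{1..M} - I"] eq[OF m q, of I] I by simp
  qed
qed

lemma aligned_iff:
  "aligned \<longleftrightarrow> (\<forall>\<T>. \<T> \<subseteq> {1..S} \<and> card \<T> = T \<longrightarrow> (\<forall>m\<in>{1..M}. \<forall>q. realization m q \<longrightarrow>
    mat_rank (stack S (\<lambda>j. blocks L ({1..M} - {m}) (q j))) =
      (\<Sum>j\<in>\<T>. mat_rank (blocks L ({1..M} - {m}) (q j)))))"
proof -
  have S: "1 \<le> S" using T_less by simp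
  have "mat_rank (stack S (\<lambda>j. blocks L ({1..M} - {m}) (q j))) = (\<Sum>j\<in>A. mat_rank (blocks L ({1..M} - {m}) (q j))) \<longleftrightarrow>
      block_rank M L q {1..S} ({1..M} - {m}) = (\<Sum>j\<in>A. block_rank M L q {j} ({1..M} - {m}))"
    if m: "m \<in> {1..M}" and q: "realization m q" and A: "A \<subseteq> {1..S}" for m q A
  proof -
    let ?I = "{1..M} - {m}"
    have I: "?I \<subseteq> {1..M}" by blast
    note dim = realization_dim_col[OF m q]
    have "real (\<Sum>j\<in>A. mat_rank (blocks L ?I (q j))) = (\<Sum>j\<in>A. block_rank M L q {j} ?I)"
      unfolding of_nat_sum by (rule sum.cong[OF refl]) (rule mat_rank_blocks[OF I dim[OF subsetD[OF A]]])
    moreover have "real (mat_rank (stack S (\<lambda>j. blocks L ?I (q j)))) = block_rank M L q {1..S} ?I"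
      by (rule mat_rank_stack_blocks[OF S I dim])
    ultimately show ?thesis by (metis of_nat_eq_iff)
  qed
  then show ?thesis unfolding aligned_def by blast
qed

lemma capacity_iff_decoupled_aligned:
  "rate = (1 - real T / real S) / (1 - (real T / real S) ^ M) \<longleftrightarrow> decoupled \<and> aligned"
  unfolding capacity_iff_download
  using optimal_imp_decoupled optimal_imp_aligned decoupled_aligned_imp_optimal by blast

end

theorem mainTheorem5:
  fixes P :: "'w measure"
    and M S L T :: nat
    and W :: "nat \<Rightarrow> 'w \<Rightarrow> 'a::{field,finite} vec"
    and Q :: "nat \<Rightarrow> nat \<Rightarrow> 'w \<Rightarrow> 'a mat"
  assumes "linear_scheme P M S L W Q"
    and "M \<ge> 2" and "S \<ge> 2" and "L \<ge> 1" and "1 \<le> T" and "T < S"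
    and "linear_scheme.correct P M S L W Q"
    and "linear_scheme.colluding_private P M S Q T"
  shows "linear_scheme.rate P M S L W Q = (1 - real T / real S) / (1 - (real T / real S) ^ M) \<longleftrightarrow>
    (\<forall>m\<in>{1..M}. \<forall>q. linear_scheme.realization P S Q m q \<longrightarrow>
       (\<forall>I'. I' \<subseteq> {1..M} - {m} \<longrightarrow>
          (let I = {1..M} - I' in
            mat_rank (stack S (\<lambda>j. blocks L I (q j))) =
            (\<Sum>j = 1..S. mat_rank (blocks L I (q j)))))) \<and>
    (\<forall>\<T>. \<T> \<subseteq> {1..S} \<and> card \<T> = T \<longrightarrow>
       (\<forall>m\<in>{1..M}. \<forall>q. linear_scheme.realization P S Q m q \<longrightarrow>
          mat_rank (stack S (\<lambda>j. blocks L ({1..M} - {m}) (q j))) =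
          (\<Sum>j\<in>\<T>. mat_rank (blocks L ({1..M} - {m}) (q j)))))"
proof -
  interpret private_linear_scheme P M S L W Q T
    by (intro private_linear_scheme.intro private_linear_scheme_axioms.intro assms)
  show ?thesis
    using capacity_iff_decoupled_aligned unfolding decoupled_iff aligned_iff .
qed


end
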